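(* Let $\{F^1_t\}_{t\ge0}$ and $\{F^2_t\}_{t\ge0}$ be one-dimensional symmetric nice Feller processes with symbols $q_1(x,\xi)$ and $q_2(x,\xi)$ and Lévy measures $\nu_1(x,dy)$ and $\nu_2(x,dy)$, respectively. Consider the condition $$\sup_{x\in\mathbb{R}}\int_0^\infty y^2\,|\nu_1(x,dy)-\nu_2(x,dy)|<\infty,\qquad (\ast)$$ where $|\mu(dy)|$ denotes the total variation measure of the signed measure $\mu(dy)$. (a) If $(\ast)$ holds and $\int_{\{|\xi|<r\}}\frac{d\xi}{\sup_{x\in\mathbb{R}}|q_1(x,\xi)|}=\infty$ for some $r>0$, then $\int_{\{|\xi|<r\}}\frac{d\xi}{\sup_{x\in\mathbb{R}}|q_2(x,\xi)|}=\infty$ for some $r>0$. (b) If $(\ast)$ holds, $\int_{\{|\xi|<r\}}\frac{d\xi}{\inf_{x\in\mathbb{R}}q_1(x,\xi)}<\infty$ for some $r>0$, and $\lim_{\xi\to0}\frac{\inf_{x\in\mathbb{R}}q_1(x,\xi)}{\xi^2}=\infty$, then also $\int_{\{|\xi|<r\}}\frac{d\xi}{\inf_{x\in\mathbb{R}}q_2(x,\xi)}<\infty$ for some $r>0$ and $\lim_{\xi\to0}\frac{\inf_{x\in\mathbb{R}}q_2(x,\xi)}{\xi^2}=\infty$.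
   Context: A Feller process $\{F_t\}_{t\ge0}$ on $\mathbb{R}$ is a Markov process with state space $(\mathbb{R},\mathcal{B}(\mathbb{R}))$, with laws $\mathbb{P}^x$ and expectations $\mathbb{E}^x$, whose semigroup $P_tf(x)=\mathbb{E}^x[f(F_t)]$ maps $C_\infty(\mathbb{R})$ (continuous functions vanishing at infinity, with the supremum norm) into itself and is strongly continuous there; it is strong Markov with càdlàg paths. Let $(\mathcal{A},\mathcal{D}_{\mathcal{A}})$ be its generator. Condition (C1): $C_c^\infty(\mathbb{R})\subseteq\mathcal{D}_{\mathcal{A}}$; then for $f\in C_c^\infty(\mathbb{R})$, $\mathcal{A}f(x)=-\int_{\mathbb{R}}q(x,\xi)e^{i\xi x}\hat f(\xi)\,d\xi$, $\hat f(\xi)=(2\pi)^{-1}\int e^{-i\xi x}f(x)\,dx$, where the symbol $q$ has a Lévy-Khintchine representation $q(x,\xi)=a(x)-i\xi b(x)+\frac12c(x)\xi^2-\int_{\mathbb{R}}(e^{i\xi y}-1-i\xi y1_{\{|y|\le1\}})\nu(x,dy)$, with $a,c\ge0$ and $b$ real-valued Borel functions and $\nu(x,dy)$ a Borel kernel (the Lévy measure) with $\nu(x,\{0\})=0$, $\int\min\{1,y^2\}\nu(x,dy)<\infty$. Condition (C2): for some $C\ge0$, $\sup_x|q(x,\xi)|\le C(1+\xi^2)$ for all $\xi$; equivalently $a$, $b$, $c$ and $x\mapsto\int\min\{1,y^2\}\nu(x,dy)$ are bounded. Condition (C3): $q(x,0)=a(x)=0$ for all $x$. For a $\sigma$-finite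 measure $\varphi$ the process is $\varphi$-irreducible if $\varphi(B)>0$ implies $\int_0^\infty\mathbb{P}^x(F_t\in B)\,dt>0$ for all $x$; then there is a maximal irreducibility measure $\psi$ (the process is $\bar\varphi$-irreducible iff $\bar\varphi\ll\psi$). Condition (C4): the process is irreducible and $\psi(O)>0$ for every nonempty open $O\subseteq\mathbb{R}$. A nice Feller process is a Feller process satisfying (C1)-(C4). It is symmetric if $q=\operatorname{Re}q$, i.e. $b=0$ and each $\nu(x,dy)$ is a symmetric measure, so that $q(x,\xi)=\frac12c(x)\xi^2+\int_{\mathbb{R}}(1-\cos\xi y)\nu(x,dy)\ge0$. Convention: $1/0=\infty$ in integrands. *)

theory Defs
  imports "HOL-Probability.Probability"
begin

section \<open>The variation of a difference of two measures\<close>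

text \<open>
  The Levy measures \<open>\<mu>\<close> and \<open>\<nu>\<close> may both have infinite mass near the origin, so \<open>\<mu> - \<nu>\<close> is in general
  defined only on the sets on which both measures are finite. The total variation measure
  \<open>|\<mu> - \<nu>|\<close> is therefore obtained by taking the supremum over finite families of disjoint
  measurable subsets on which both measures are finite. Lemma \<open>emeasure_variation_diff\<close> shows that
  this set function is a measure.
\<close>

definition variation_families :: "'a measure \<Rightarrow> 'a measure \<Rightarrow> 'a set \<Rightarrow> 'a set set set" where
  "variation_families \<mu> \<nu> B =
     {\<A>. finite \<A> \<and> disjoint \<A> \<and>
        (\<forall>A\<in>\<A>. A \<in> sets \<mu> \<and> A \<subseteq> B \<and> emeasure \<mu> A < \<infinity> \<and> emeasure \<nu> A < \<infinity>)}"

definition variation :: "'a measure \<Rightarrow> 'a measure \<Rightarrow> 'a set \<Rightarrow> ennreal" where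
  "variation \<mu> \<nu> B =
     (SUP \<A>\<in>variation_families \<mu> \<nu> B. \<Sum>A\<in>\<A>. ennreal \<bar>measure \<mu> A - measure \<nu> A\<bar>)"

definition variation_diff :: "'a measure \<Rightarrow> 'a measure \<Rightarrow> 'a measure" where
  "variation_diff \<mu> \<nu> = measure_of (space \<mu>) (sets \<mu>) (variation \<mu> \<nu>)"

lemma space_variation_diff [simp]: "space (variation_diff \<mu> \<nu>) = space \<mu>"
  by (simp add: variation_diff_def)

lemma sets_variation_diff [simp, measurable_cong]: "sets (variation_diff \<mu> \<nu>) = sets \<mu>"
  by (simp add: variation_diff_def)

lemma empty_in_variation_families: "{} \<in> variation_families \<mu> \<nu> B"
  by (auto simp: variation_families_def)

lemma variation_mono: "B \<subseteq> C \<Longrightarrow> variation \<mu> \<nu> B \<le> variation \<mu> \<nu> C"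
  unfolding variation_def by (intro SUP_subset_mono) (auto simp: variation_families_def)

lemma variation_superadditive:
  assumes "B \<inter> C = {}"
  shows "variation \<mu> \<nu> B + variation \<mu> \<nu> C \<le> variation \<mu> \<nu> (B \<union> C)"
proof -
  let ?s = "\<lambda>\<A>. \<Sum>A\<in>\<A>. ennreal \<bar>measure \<mu> A - measure \<nu> A\<bar>"
  have 1: "?s \<A> + ?s \<C> \<le> variation \<mu> \<nu> (B \<union> C)"
    if A: "\<A> \<in> variation_families \<mu> \<nu> B" and C: "\<C> \<in> variation_families \<mu> \<nu> C" for \<A> \<C>
  proof -
    have sub: "\<And>X Y. X \<in> \<A> \<Longrightarrow> Y \<in> \<C> \<Longrightarrow> X \<inter> Y = {}"
      using A C assms unfolding variation_families_def by blast
    have fin: "finite \<A>" "finite \<C>" using A C by (auto simp: variation_families_def)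
    have "?s \<A> + ?s \<C> = ?s (\<A> \<union> \<C>)"
    proof (rule sum.union_inter_neutral[symmetric, OF fin], intro ballI)
      fix X assume "X \<in> \<A> \<inter> \<C>"
      then have "X = {}" using sub[of X X] by auto
      then show "ennreal \<bar>measure \<mu> X - measure \<nu> X\<bar> = 0" by simp
    qed
    also have "\<A> \<union> \<C> \<in> variation_families \<mu> \<nu> (B \<union> C)"
    proof -
      have "disjoint \<A>" "disjoint \<C>" using A C by (auto simp: variation_families_def)
      then have "disjoint (\<A> \<union> \<C>)"
        using sub unfolding disjoint_def by blast
      then show ?thesis using A C unfolding variation_families_def by blast
    qed
    then have "?s (\<A> \<union> \<C>) \<le> variation \<mu> \<nu> (B \<union> C)"
      unfolding variation_def by (intro SUP_upper)
    finally show ?thesis .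
  qed
  have ne: "variation_families \<mu> \<nu> X \<noteq> {}" for X
    using empty_in_variation_families by blast
  have 2: "?s \<A> + variation \<mu> \<nu> C \<le> variation \<mu> \<nu> (B \<union> C)"
    if A: "\<A> \<in> variation_families \<mu> \<nu> B" for \<A>
  proof -
    have "?s \<A> + variation \<mu> \<nu> C = (SUP \<C>\<in>variation_families \<mu> \<nu> C. ?s \<A> + ?s \<C>)"
      unfolding variation_def using ne by (rule ennreal_SUP_add_right)
    also have "\<dots> \<le> variation \<mu> \<nu> (B \<union> C)"
      by (intro SUP_least 1 A)
    finally show ?thesis .
  qed
  have "variation \<mu> \<nu> B + variation \<mu> \<nu> C
      = (SUP \<A>\<in>variation_families \<mu> \<nu> B. ?s \<A> + variation \<mu> \<nu> C)"
    unfolding variation_def[of \<mu> \<nu> B] using ne by (rule ennreal_SUP_add_left[symmetric])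
  also have "\<dots> \<le> variation \<mu> \<nu> (B \<union> C)"
    by (intro SUP_least 2)
  finally show ?thesis .
qed

lemma variation_empty [simp]: "variation \<mu> \<nu> {} = 0"
proof -
  have "(\<Sum>A\<in>\<A>. ennreal \<bar>measure \<mu> A - measure \<nu> A\<bar>) = 0"
    if "\<A> \<in> variation_families \<mu> \<nu> {}" for \<A>
    using that by (intro sum.neutral) (auto simp: variation_families_def)
  then show ?thesis
    unfolding variation_def by (auto intro!: SUP_eq_const empty_in_variation_families)
qed

lemma variation_countably_additive:
  assumes sets: "sets \<nu> = sets \<mu>"
  shows "countably_additive (sets \<mu>) (variation \<mu> \<nu>)"
proof (rule countably_additiveI)
  fix B :: "nat \<Rightarrow> 'a set"
  assume B: "range B \<subseteq> sets \<mu>" "disjoint_family B"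
  have [measurable]: "B n \<in> sets \<mu>" for n using B by auto
  show "(\<Sum>n. variation \<mu> \<nu> (B n)) = variation \<mu> \<nu> (\<Union>n. B n)"
  proof (rule antisym)
    have "(\<Sum>n<N. variation \<mu> \<nu> (B n)) \<le> variation \<mu> \<nu> (\<Union>n<N. B n)" for N
    proof (induction N)
      case (Suc N)
      have "B n \<inter> B N = {}" if "n < N" for n
        using B(2) that by (simp add: disjoint_family_on_def)
      then have "(\<Union>n<N. B n) \<inter> B N = {}" by blast
      then have "variation \<mu> \<nu> (\<Union>n<N. B n) + variation \<mu> \<nu> (B N)
          \<le> variation \<mu> \<nu> ((\<Union>n<N. B n) \<union> B N)"
        by (rule variation_superadditive)
      moreover have "(\<Union>n<N. B n) \<union> B N = (\<Union>n<Suc N. B n)"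
        by (simp only: lessThan_Suc UN_insert Un_commute)
      ultimately show ?case
        unfolding sum.lessThan_Suc
        by (intro order_trans[OF add_right_mono[OF Suc.IH]]) (simp only:)
    qed simp
    also have "variation \<mu> \<nu> (\<Union>n<N. B n) \<le> variation \<mu> \<nu> (\<Union>n. B n)" for N
      by (intro variation_mono) auto
    finally show "(\<Sum>n. variation \<mu> \<nu> (B n)) \<le> variation \<mu> \<nu> (\<Union>n. B n)"
      by (intro suminf_le_const summableI)
  next
    show "variation \<mu> \<nu> (\<Union>n. B n) \<le> (\<Sum>n. variation \<mu> \<nu> (B n))"
      unfolding variation_def[of \<mu> \<nu> "\<Union>n. B n"]
    proof (rule SUP_least)
      fix \<A> assume A: "\<A> \<in> variation_families \<mu> \<nu> (\<Union>n. B n)"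
      let ?d = "\<lambda>A. ennreal \<bar>measure \<mu> A - measure \<nu> A\<bar>"
      have fin_in: "emeasure \<mu> C = ennreal (measure \<mu> C)" "emeasure \<nu> C = ennreal (measure \<nu> C)"
        "emeasure \<mu> C < \<infinity>" "emeasure \<nu> C < \<infinity>"
        if "C \<subseteq> A'" "A' \<in> \<A>" for C A'
      proof -
        have *: "A' \<in> sets \<mu>" "A' \<in> sets \<nu>" "emeasure \<mu> A' < \<infinity>" "emeasure \<nu> A' < \<infinity>"
          using A that(2) sets by (auto simp: variation_families_def)
        then have "emeasure \<mu> C < \<infinity>" "emeasure \<nu> C < \<infinity>"
          using emeasure_mono[OF that(1) *(1)] emeasure_mono[OF that(1) *(2)] le_less_trans by blast+
        then show "emeasure \<mu> C < \<infinity>" "emeasure \<nu> C < \<infinity>"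
          "emeasure \<mu> C = ennreal (measure \<mu> C)" "emeasure \<nu> C = ennreal (measure \<nu> C)"
          by (simp_all add: emeasure_eq_ennreal_measure less_top)
      qed
      have abs_bound: "ennreal \<bar>measure \<mu> X - measure \<nu> X\<bar> \<le> D"
        if "ennreal (measure \<mu> X) \<le> ennreal (measure \<nu> X) + D"
          "ennreal (measure \<nu> X) \<le> ennreal (measure \<mu> X) + D" for X D
      proof (cases D)
        case (real d)
        then show ?thesis
          using that by (simp flip: ennreal_plus add: abs_le_iff)
      qed simp
      have split: "?d X \<le> (\<Sum>n. ?d (X \<inter> B n))" if X: "X \<in> \<A>" for X
      proof -
        have [measurable]: "X \<in> sets \<mu>" and XB: "X \<subseteq> (\<Union>n. B n)"
          using A X by (auto simp: variation_families_def)
        have XU: "X = (\<Union>n. X \<inter> B n)" using XB by auto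
        have dj: "disjoint_family (\<lambda>n. X \<inter> B n)"
          using B(2) unfolding disjoint_family_on_def by blast
        have sm: "emeasure M X = (\<Sum>n. emeasure M (X \<inter> B n))" if "sets M = sets \<mu>" for M
        proof -
          have "X \<inter> B n \<in> sets M" for n
            unfolding that by measurable
          then have "range (\<lambda>n. X \<inter> B n) \<subseteq> sets M" by blast
          from suminf_emeasure[OF this dj]
          have "(\<Sum>n. emeasure M (X \<inter> B n)) = emeasure M (\<Union>n. X \<inter> B n)" .
          also have "(\<Union>n. X \<inter> B n) = X" by (rule XU[symmetric])
          finally show ?thesis by (rule sym)
        qed
        have le: "emeasure \<mu> (X \<inter> B n) \<le> emeasure \<nu> (X \<inter> B n) + ?d (X \<inter> B n)"
          "emeasure \<nu> (X \<inter> B n) \<le> emeasure \<mu> (X \<inter> B n) + ?d (X \<inter> B n)" for n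
        proof -
          have *: "ennreal u \<le> ennreal v + ennreal \<bar>u - v\<bar>"
            "ennreal u \<le> ennreal v + ennreal \<bar>v - u\<bar>" if "0 \<le> v" for u v :: real
            using that by (simp_all flip: ennreal_plus)
          have **: "X \<inter> B n \<subseteq> X" by auto
          show "emeasure \<mu> (X \<inter> B n) \<le> emeasure \<nu> (X \<inter> B n) + ?d (X \<inter> B n)"
            "emeasure \<nu> (X \<inter> B n) \<le> emeasure \<mu> (X \<inter> B n) + ?d (X \<inter> B n)"
            unfolding fin_in(1)[OF ** X] fin_in(2)[OF ** X] by (rule *, simp)+
        qed
        have "emeasure \<mu> X \<le> emeasure \<nu> X + (\<Sum>n. ?d (X \<inter> B n))"
          unfolding sm[OF refl] sm[OF sets] suminf_add[OF summableI summableI]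
          by (intro suminf_le le summableI)
        moreover have "emeasure \<nu> X \<le> emeasure \<mu> X + (\<Sum>n. ?d (X \<inter> B n))"
          unfolding sm[OF refl] sm[OF sets] suminf_add[OF summableI summableI]
          by (intro suminf_le le summableI)
        ultimately show ?thesis
          unfolding fin_in(1)[OF order_refl X] fin_in(2)[OF order_refl X] by (rule abs_bound)
      qed
      have fin: "finite \<A>" using A by (auto simp: variation_families_def)
      have "(\<Sum>X\<in>\<A>. ?d X) \<le> (\<Sum>X\<in>\<A>. \<Sum>n. ?d (X \<inter> B n))"
        by (intro sum_mono split)
      also have "\<dots> = (\<Sum>n. \<Sum>X\<in>\<A>. ?d (X \<inter> B n))"
        by (rule suminf_sum[OF summableI, symmetric])
      also have "\<dots> \<le> (\<Sum>n. variation \<mu> \<nu> (B n))"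
      proof (intro suminf_le summableI)
        fix n
        have dj: "disjoint \<A>" using A by (auto simp: variation_families_def)
        have "(\<Sum>X\<in>\<A>. ?d (X \<inter> B n)) = (\<Sum>Y\<in>(\<lambda>X. X \<inter> B n) ` \<A>. ?d Y)"
        proof (subst sum.reindex_nontrivial[OF fin])
          fix X Y assume "X \<in> \<A>" "Y \<in> \<A>" "X \<noteq> Y" and eq: "X \<inter> B n = Y \<inter> B n"
          then have "X \<inter> B n = {}" using dj unfolding disjoint_def by blast
          then show "?d (X \<inter> B n) = 0" by simp
        qed simp
        also have "\<dots> \<le> variation \<mu> \<nu> (B n)"
          unfolding variation_def
        proof (rule SUP_upper)
          show "(\<lambda>X. X \<inter> B n) ` \<A> \<in> variation_families \<mu> \<nu> (B n)"
            unfolding variation_families_def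
          proof (intro CollectI conjI ballI)
            show "disjoint ((\<lambda>X. X \<inter> B n) ` \<A>)"
              using dj unfolding disjoint_def by blast
          next
            fix Y assume "Y \<in> (\<lambda>X. X \<inter> B n) ` \<A>"
            then obtain X where X: "X \<in> \<A>" "Y = X \<inter> B n" by auto
            show "Y \<in> sets \<mu>" "Y \<subseteq> B n" "emeasure \<mu> Y < \<infinity>" "emeasure \<nu> Y < \<infinity>"
              using fin_in[of Y X] X A by (auto simp: variation_families_def)
          qed (use fin in auto)
        qed
        finally show "(\<Sum>X\<in>\<A>. ?d (X \<inter> B n)) \<le> variation \<mu> \<nu> (B n)" .
      qed
      finally show "(\<Sum>X\<in>\<A>. ?d X) \<le> (\<Sum>n. variation \<mu> \<nu> (B n))" .
    qed
  qed
qed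

lemma emeasure_variation_diff:
  assumes "sets \<nu> = sets \<mu>" "B \<in> sets \<mu>"
  shows "emeasure (variation_diff \<mu> \<nu>) B = variation \<mu> \<nu> B"
  unfolding variation_diff_def
  by (rule emeasure_measure_of_sigma)
     (use assms variation_countably_additive[OF assms(1)] in
       \<open>auto simp: sets.sigma_algebra_axioms positive_def\<close>)


section \<open>Function spaces on the real line\<close>

definition C_infty :: "(real \<Rightarrow> real) set" where
  "C_infty = {f. continuous_on UNIV f \<and> (f \<longlongrightarrow> 0) at_infinity}"

definition C_c_smooth :: "(real \<Rightarrow> real) set" where
  "C_c_smooth = {f. (\<forall>n x. (deriv ^^ n) f field_differentiable (at x)) \<and>
                    compact (closure {x. f x \<noteq> 0})}"

definition fourier :: "(real \<Rightarrow> real) \<Rightarrow> real \<Rightarrow> complex" where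
  "fourier f \<xi> = (1 / (2 * pi)) * (\<integral>x. iexp (- \<xi> * x) * complex_of_real (f x) \<partial>lborel)"


section \<open>Feller processes\<close>

text \<open>
  A process consists of a measurable space \<open>\<Omega>\<close> (only the sigma-algebra of this measure is used),
  the laws \<open>P x\<close> on it, and the random variables \<open>F t\<close>, which are meaningful for \<open>t \<ge> 0\<close> only.
  The natural filtration is indexed by \<^typ>\<open>ennreal\<close>, so that stopping times in the sense of
  \<^const>\<open>stopping_time\<close> are nonnegative and may take the value \<open>\<infinity>\<close>.
\<close>

definition natural_filtration ::
  "'w measure \<Rightarrow> (real \<Rightarrow> 'w \<Rightarrow> real) \<Rightarrow> ennreal \<Rightarrow> 'w measure" where
  "natural_filtration \<Omega> F t =
     sigma (space \<Omega>) {F s -` B \<inter> space \<Omega> | s B. 0 \<le> s \<and> ennreal s \<le> t \<and> B \<in> sets borel}"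

definition transition ::
  "(real \<Rightarrow> 'w measure) \<Rightarrow> (real \<Rightarrow> 'w \<Rightarrow> real) \<Rightarrow> real \<Rightarrow> real \<Rightarrow> real set \<Rightarrow> ennreal" where
  "transition P F t x B = emeasure (P x) {\<omega> \<in> space (P x). F t \<omega> \<in> B}"

locale markov_process =
  fixes \<Omega> :: "'w measure" and P :: "real \<Rightarrow> 'w measure" and F :: "real \<Rightarrow> 'w \<Rightarrow> real"
  assumes laws: "P x \<in> space (prob_algebra \<Omega>)"
    and random_variable: "0 \<le> t \<Longrightarrow> F t \<in> borel_measurable \<Omega>"
    and transition_measurable:
      "0 \<le> t \<Longrightarrow> B \<in> sets borel \<Longrightarrow> (\<lambda>x. transition P F t x B) \<in> borel_measurable borel"
    and start: "AE \<omega> in P x. F 0 \<omega> = x"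
    and markov: "0 \<le> s \<Longrightarrow> 0 \<le> t \<Longrightarrow> B \<in> sets borel \<Longrightarrow>
      AE \<omega> in P x. real_cond_exp (P x) (natural_filtration \<Omega> F (ennreal s))
          (\<lambda>\<omega>'. indicator B (F (s + t) \<omega>')) \<omega> = enn2real (transition P F t (F s \<omega>) B)"

definition semigroup ::
  "(real \<Rightarrow> 'w measure) \<Rightarrow> (real \<Rightarrow> 'w \<Rightarrow> real) \<Rightarrow> real \<Rightarrow> (real \<Rightarrow> real) \<Rightarrow> real \<Rightarrow> real" where
  "semigroup P F t f x = (\<integral>\<omega>. f (F t \<omega>) \<partial>P x)"

text \<open>
  In the strong Markov property, the value of \<open>F (T + t)\<close> on the event \<open>T = \<infinity>\<close>
  is irrelevant: this event belongs to the sigma-algebra of \<open>T\<close> and is excluded from the identity.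
\<close>

locale feller_process = markov_process \<Omega> P F
  for \<Omega> :: "'w measure" and P :: "real \<Rightarrow> 'w measure" and F :: "real \<Rightarrow> 'w \<Rightarrow> real" +
  assumes feller: "0 \<le> t \<Longrightarrow> f \<in> C_infty \<Longrightarrow> semigroup P F t f \<in> C_infty"
    and strongly_continuous: "f \<in> C_infty \<Longrightarrow>
      uniform_limit UNIV (\<lambda>t. semigroup P F t f) f (at_right 0)"
    and right_continuous: "\<omega> \<in> space \<Omega> \<Longrightarrow> 0 \<le> t \<Longrightarrow> ((\<lambda>s. F s \<omega>) \<longlongrightarrow> F t \<omega>) (at_right t)"
    and left_limits: "\<omega> \<in> space \<Omega> \<Longrightarrow> 0 < t \<Longrightarrow> \<exists>l. ((\<lambda>s. F s \<omega>) \<longlongrightarrow> l) (at_left t)"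
    and strong_markov: "stopping_time (natural_filtration \<Omega> F) T \<Longrightarrow> 0 \<le> t \<Longrightarrow> B \<in> sets borel \<Longrightarrow>
      AE \<omega> in P x. T \<omega> < \<infinity> \<longrightarrow>
        real_cond_exp (P x) (filtration.pre_sigma (space \<Omega>) (natural_filtration \<Omega> F) T)
          (\<lambda>\<omega>'. indicator B (F (enn2real (T \<omega>') + t) \<omega>')) \<omega>
        = enn2real (transition P F t (F (enn2real (T \<omega>)) \<omega>) B)"

definition is_generator_value ::
  "(real \<Rightarrow> 'w measure) \<Rightarrow> (real \<Rightarrow> 'w \<Rightarrow> real) \<Rightarrow> (real \<Rightarrow> real) \<Rightarrow> (real \<Rightarrow> real) \<Rightarrow> bool" where
  "is_generator_value P F f g \<longleftrightarrow> g \<in> C_infty \<and>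
     uniform_limit UNIV (\<lambda>t x. (semigroup P F t f x - f x) / t) g (at_right 0)"

definition generator_domain ::
  "(real \<Rightarrow> 'w measure) \<Rightarrow> (real \<Rightarrow> 'w \<Rightarrow> real) \<Rightarrow> (real \<Rightarrow> real) set" where
  "generator_domain P F = {f \<in> C_infty. \<exists>g. is_generator_value P F f g}"

definition generator ::
  "(real \<Rightarrow> 'w measure) \<Rightarrow> (real \<Rightarrow> 'w \<Rightarrow> real) \<Rightarrow> (real \<Rightarrow> real) \<Rightarrow> real \<Rightarrow> real" where
  "generator P F f = (THE g. is_generator_value P F f g)"


section \<open>Symbols and nice Feller processes\<close>

definition levy_khintchine ::
  "(real \<Rightarrow> real) \<Rightarrow> (real \<Rightarrow> real) \<Rightarrow> (real \<Rightarrow> real) \<Rightarrow> (real \<Rightarrow> real measure) \<Rightarrow>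
   real \<Rightarrow> real \<Rightarrow> complex" where
  "levy_khintchine a b c \<nu> x \<xi> =
     complex_of_real (a x) - \<i> * complex_of_real (\<xi> * b x)
     + complex_of_real (c x * \<xi>\<^sup>2 / 2)
     - (\<integral>y. (iexp (\<xi> * y) - 1 - \<i> * complex_of_real (\<xi> * y * indicator {y. \<bar>y\<bar> \<le> 1} y)) \<partial>\<nu> x)"

locale levy_characteristics =
  fixes a b c :: "real \<Rightarrow> real" and \<nu> :: "real \<Rightarrow> real measure"
  assumes borel_coefficients:
      "a \<in> borel_measurable borel" "b \<in> borel_measurable borel" "c \<in> borel_measurable borel"
    and nonneg_coefficients: "0 \<le> a x" "0 \<le> c x"
    and sets_levy_measure: "sets (\<nu> x) = sets borel"
    and levy_kernel: "B \<in> sets borel \<Longrightarrow> (\<lambda>x. emeasure (\<nu> x) B) \<in> borel_measurable borel"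
    and levy_measure_zero: "emeasure (\<nu> x) {0} = 0"
    and levy_measure_integrable: "(\<integral>\<^sup>+ y. ennreal (min 1 (y\<^sup>2)) \<partial>\<nu> x) < \<infinity>"

definition phi_irreducible ::
  "(real \<Rightarrow> 'w measure) \<Rightarrow> (real \<Rightarrow> 'w \<Rightarrow> real) \<Rightarrow> real measure \<Rightarrow> bool" where
  "phi_irreducible P F \<phi> \<longleftrightarrow>
     (\<forall>B\<in>sets borel. 0 < emeasure \<phi> B \<longrightarrow>
        (\<forall>x. 0 < (\<integral>\<^sup>+ t\<in>{0..}. transition P F t x B \<partial>lborel)))"

definition maximal_irreducibility_measure ::
  "(real \<Rightarrow> 'w measure) \<Rightarrow> (real \<Rightarrow> 'w \<Rightarrow> real) \<Rightarrow> real measure \<Rightarrow> bool" where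
  "maximal_irreducibility_measure P F \<psi> \<longleftrightarrow>
     sets \<psi> = sets borel \<and> sigma_finite_measure \<psi> \<and> phi_irreducible P F \<psi> \<and>
     (\<forall>\<phi>. sets \<phi> = sets borel \<longrightarrow> sigma_finite_measure \<phi> \<longrightarrow>
        (phi_irreducible P F \<phi> \<longleftrightarrow> absolutely_continuous \<psi> \<phi>))"

text \<open>
  The assumptions \<open>C1\<close> and \<open>symbol\<close> say that \<open>q\<close> is the symbol of the process;
  \<open>(a, b, c, \<nu>)\<close> are its characteristics.
\<close>

locale nice_feller_process =
  feller_process \<Omega> P F + levy_characteristics a b c \<nu>
  for \<Omega> :: "'w measure" and P :: "real \<Rightarrow> 'w measure" and F :: "real \<Rightarrow> 'w \<Rightarrow> real"
    and q :: "real \<Rightarrow> real \<Rightarrow> complex"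
    and a b c :: "real \<Rightarrow> real" and \<nu> :: "real \<Rightarrow> real measure" +
  assumes C1: "C_c_smooth \<subseteq> generator_domain P F"
    and symbol: "f \<in> C_c_smooth \<Longrightarrow> complex_of_real (generator P F f x)
      = - (\<integral>\<xi>. q x \<xi> * iexp (\<xi> * x) * fourier f \<xi> \<partial>lborel)"
    and representation: "q x \<xi> = levy_khintchine a b c \<nu> x \<xi>"
    and C2: "\<exists>C\<ge>0. \<forall>\<xi> x. cmod (q x \<xi>) \<le> C * (1 + \<xi>\<^sup>2)"
    and C3: "q x 0 = 0"
    and C4: "\<exists>\<psi>. maximal_irreducibility_measure P F \<psi> \<and>
      (\<forall>U. open U \<longrightarrow> U \<noteq> {} \<longrightarrow> 0 < emeasure \<psi> U)"

locale symmetric_nice_feller_process = nice_feller_process \<Omega> P F q a b c \<nu>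
  for \<Omega> :: "'w measure" and P :: "real \<Rightarrow> 'w measure" and F :: "real \<Rightarrow> 'w \<Rightarrow> real"
    and q :: "real \<Rightarrow> real \<Rightarrow> complex"
    and a b c :: "real \<Rightarrow> real" and \<nu> :: "real \<Rightarrow> real measure" +
  assumes symmetric: "q x \<xi> = complex_of_real (Re (q x \<xi>))"

end

theory Submission
  imports Defs
begin

text \<open>
  Since the symbols are real, \<open>\<nu>\<^sub>1(x, dy)\<close> and \<open>\<nu>\<^sub>2(x, dy)\<close> weigh the two half-lines equally, so the
  condition on \<open>(0, \<infinity>)\<close> together with \<open>1 - cos t \<le> t\<^sup>2 / 2\<close> and the boundedness of the diffusion
  coefficients gives \<open>\<bar>q\<^sub>1(x, \<xi>) - q\<^sub>2(x, \<xi>)\<bar> \<le> K * \<xi>\<^sup>2\<close> with \<open>K\<close> independent of \<open>x\<close>. In (b) the infimum of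
  \<open>q\<^sub>1\<close> dominates \<open>\<xi>\<^sup>2\<close> near \<open>0\<close> and the perturbation is absorbed. In (a) the supremum \<open>S\<^sub>1\<close> of \<open>q\<^sub>1\<close> is
  bounded below by a multiple of \<open>\<xi>\<^sup>2\<close> near \<open>0\<close>, unless it vanishes identically, so \<open>S\<^sub>2 \<le> C * S\<^sub>1\<close>
  there. It remains to see that the integral of \<open>1 / S\<^sub>1\<close> diverges already near \<open>0\<close>: otherwise
  compactness yields a point \<open>\<xi>\<^sub>0\<close> near which it diverges, lower semicontinuity forces \<open>S\<^sub>1(\<xi>\<^sub>0) = 0\<close>,
  and then \<open>S\<^sub>1(h) \<le> 2 * S\<^sub>1(\<xi>\<^sub>0 + h)\<close> moves the divergence to \<open>0\<close>.
\<close>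

section \<open>Integrals against the variation of a difference\<close>

lemma variation_commute: "sets \<mu> = sets \<nu> \<Longrightarrow> variation \<mu> \<nu> B = variation \<nu> \<mu> B"
  unfolding variation_def variation_families_def
  by (intro SUP_cong sum.cong) (auto simp: abs_minus_commute)

lemma variation_diff_commute:
  assumes "sets \<mu> = sets \<nu>"
  shows "variation_diff \<mu> \<nu> = variation_diff \<nu> \<mu>"
proof -
  have "variation \<mu> \<nu> = variation \<nu> \<mu>"
    using variation_commute[OF assms] by (rule ext)
  then show ?thesis
    unfolding variation_diff_def using assms sets_eq_imp_space_eq[OF assms] by simp
qed

text \<open>The one-member family \<open>{B}\<close> is admissible because both measures are finite
  on \<open>B\<close>, so the variation of \<open>B\<close> dominates the distance between the two
  masses.\<close>

lemma emeasure_le_emeasure_add_variation_finite: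
  assumes sets: "sets \<nu> = sets \<mu>" and B: "B \<in> sets \<mu>"
    and fin: "emeasure \<mu> B < \<infinity>" "emeasure \<nu> B < \<infinity>"
  shows "emeasure \<mu> B \<le> emeasure \<nu> B + variation \<mu> \<nu> B"
proof -
  have "{B} \<in> variation_families \<mu> \<nu> B"
    using B fin by (auto simp: variation_families_def disjoint_def)
  then have "(\<Sum>A\<in>{B}. ennreal \<bar>measure \<mu> A - measure \<nu> A\<bar>) \<le> variation \<mu> \<nu> B"
    unfolding variation_def by (rule SUP_upper)
  then have *: "ennreal \<bar>measure \<mu> B - measure \<nu> B\<bar> \<le> variation \<mu> \<nu> B" by simp
  have "emeasure \<mu> B = ennreal (measure \<mu> B)"
    using fin by (simp add: emeasure_eq_ennreal_measure less_top)
  also have "\<dots> \<le> ennreal (measure \<nu> B + \<bar>measure \<mu> B - measure \<nu> B\<bar>)"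
    by (intro ennreal_leI) linarith
  also have "\<dots> = emeasure \<nu> B + ennreal \<bar>measure \<mu> B - measure \<nu> B\<bar>"
    using fin by (simp add: emeasure_eq_ennreal_measure less_top)
  finally show ?thesis
    using * by (meson add_left_mono order_trans)
qed

text \<open>The masses of \<open>B\<close> may be infinite, so the finite case is applied to the
  traces of \<open>B\<close> on the sets \<open>A n\<close>, and continuity from below of \<mu>
  recovers \<open>B\<close>.\<close>

lemma emeasure_le_emeasure_add_variation_diff:
  assumes sets: "sets \<nu> = sets \<mu>" and B: "B \<in> sets \<mu>"
    and A: "incseq A" "\<And>n::nat. A n \<in> sets \<mu>"
      "\<And>n. emeasure \<mu> (A n) < \<infinity>" "\<And>n. emeasure \<nu> (A n) < \<infinity>"
    and null: "emeasure \<mu> (space \<mu> - (\<Union>n. A n)) = 0"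
  shows "emeasure \<mu> B \<le> emeasure \<nu> B + emeasure (variation_diff \<mu> \<nu>) B"
proof -
  note [measurable] = A(2) B
  have "emeasure \<mu> B \<le> emeasure \<mu> ((\<Union>n. B \<inter> A n) \<union> (space \<mu> - (\<Union>n. A n)))"
    using sets.sets_into_space[OF B] by (intro emeasure_mono) auto
  also have "\<dots> \<le> emeasure \<mu> (\<Union>n. B \<inter> A n) + emeasure \<mu> (space \<mu> - (\<Union>n. A n))"
    by (intro emeasure_subadditive) measurable
  also have "\<dots> = (SUP n. emeasure \<mu> (B \<inter> A n))"
    unfolding null using A(1)
    by (subst SUP_emeasure_incseq) (auto simp: incseq_def)
  also have "\<dots> \<le> emeasure \<nu> B + variation \<mu> \<nu> B"
  proof (rule SUP_least)
    fix n
    have "emeasure \<mu> (B \<inter> A n) < \<infinity>" "emeasure \<nu> (B \<inter> A n) < \<infinity>"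
      using A(2-4)[of n] sets
      by (auto intro: le_less_trans[OF emeasure_mono[of "B \<inter> A n" "A n"]])
    then have "emeasure \<mu> (B \<inter> A n) \<le> emeasure \<nu> (B \<inter> A n) + variation \<mu> \<nu> (B \<inter> A n)"
      by (intro emeasure_le_emeasure_add_variation_finite sets) auto
    also have "\<dots> \<le> emeasure \<nu> B + variation \<mu> \<nu> B"
      using B sets by (intro add_mono variation_mono emeasure_mono) auto
    finally show "emeasure \<mu> (B \<inter> A n) \<le> emeasure \<nu> B + variation \<mu> \<nu> B" .
  qed
  finally show ?thesis
    by (simp add: emeasure_variation_diff[OF sets B])
qed

text \<open>Carries an inequality between measures over to integrands by the standard induction on
  nonnegative measurable functions.\<close>

lemma nn_integral_le_add_of_emeasure_le:
  assumes sets: "sets N = sets M" "sets L = sets M"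
    and le: "\<And>B. B \<in> sets M \<Longrightarrow> emeasure M B \<le> emeasure N B + emeasure L B"
    and f: "f \<in> borel_measurable M"
  shows "(\<integral>\<^sup>+x. f x \<partial>M) \<le> (\<integral>\<^sup>+x. f x \<partial>N) + (\<integral>\<^sup>+x. f x \<partial>L)"
  using f
proof induction
  note sp = sets_eq_imp_space_eq[OF sets(1)] sets_eq_imp_space_eq[OF sets(2)]
  note ms = measurable_cong_sets[OF sets(1) refl] measurable_cong_sets[OF sets(2) refl]
  {
    case (cong f g)
    then have "integral\<^sup>N K f = integral\<^sup>N K g" if "space K = space M" for K
      using that by (intro nn_integral_cong) simp
    then show ?case using cong sp by simp
  next
    case (set A)
    then show ?case using le[of A] sets by simp
  next
    case (mult u c)
    then have "c * (\<integral>\<^sup>+x. u x \<partial>M) \<le> c * ((\<integral>\<^sup>+x. u x \<partial>N) + (\<integral>\<^sup>+x. u x \<partial>L))"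
      by (intro mult_left_mono) auto
    then show ?case using mult by (simp add: nn_integral_cmult ms distrib_left)
  next
    case (add u v)
    then show ?case
      using add_mono[OF add.IH(1) add.IH(2)] by (simp add: nn_integral_add ms ac_simps)
  next
    case (seq U)
    have *: "(\<integral>\<^sup>+x. (SUP i. U i) x \<partial>K) = (SUP i. \<integral>\<^sup>+x. U i x \<partial>K)" if "sets K = sets M" for K
    proof -
      have "U i \<in> borel_measurable K" for i
        unfolding measurable_cong_sets[OF that refl] by (rule seq.hyps(1))
      then show ?thesis
        using nn_integral_monotone_convergence_SUP[OF \<open>incseq U\<close>] by (simp add: image_image)
    qed
    \<comment> \<open>Splitting the supremum of the sums into a sum of suprema requires both
      sequences of integrals to increase.\<close>
    have mono: "incseq (\<lambda>i. \<integral>\<^sup>+x. U i x \<partial>K)" for K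
      using \<open>incseq U\<close> by (auto simp: incseq_def le_fun_def intro!: nn_integral_mono)
    have "(\<integral>\<^sup>+x. (SUP i. U i) x \<partial>M) \<le> (SUP i. (\<integral>\<^sup>+x. U i x \<partial>N) + (\<integral>\<^sup>+x. U i x \<partial>L))"
      unfolding *[OF refl] using seq.IH by (intro SUP_mono) auto
    also have "\<dots> = (\<integral>\<^sup>+x. (SUP i. U i) x \<partial>N) + (\<integral>\<^sup>+x. (SUP i. U i) x \<partial>L)"
      unfolding *[OF sets(1)] *[OF sets(2)] by (intro ennreal_SUP_add mono)
    finally show ?case by simp
  }
qed

section \<open>Integrals of reciprocals near the origin\<close>

text \<open>Serves suprema over all real \<open>x\<close>: an uncountable supremum of continuous
  functions is still lower semicontinuous, hence Borel.\<close>

lemma borel_measurable_of_open_superlevel: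
  fixes f :: "real \<Rightarrow> real"
  assumes "\<And>t. open {x. t < f x}"
  shows "f \<in> borel_measurable borel"
  unfolding borel_measurable_iff_greater using assms by auto

lemma inverse_le_ennreal:
  fixes s t :: real
  assumes "0 \<le> s" "0 \<le> t" "0 < C" "s \<le> C * t"
  shows "1 / ennreal t \<le> ennreal C * (1 / ennreal s)"
proof (cases "s = 0")
  \<comment> \<open>The right-hand side is a positive constant times infinity. This is also the only
    case in which \<open>t\<close> can be 0.\<close>
  case True
  then show ?thesis using assms by (simp add: ennreal_mult_top)
next
  case False
  then have "0 < s" "0 < t" using assms by (auto simp: zero_less_mult_iff less_le)
  have inv: "1 / ennreal v = ennreal (1 / v)" if "0 < v" for v :: real
    using divide_ennreal[of 1 v] that by simp
  have "1 / t \<le> C * (1 / s)" using assms \<open>0 < s\<close> \<open>0 < t\<close> by (simp add: field_simps)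
  then have "ennreal (1 / t) \<le> ennreal (C * (1 / s))" by (rule ennreal_leI)
  also have "\<dots> = ennreal C * ennreal (1 / s)"
    using assms by (intro ennreal_mult) auto
  finally show ?thesis unfolding inv[OF \<open>0 < s\<close>] inv[OF \<open>0 < t\<close>] .
qed

text \<open>A small \<xi> has an integer multiple \<open>k * \<xi>\<close> close to \<xi>0, where
  \<open>S\<close> stays above \<open>S \<xi>0 / 2\<close>. Hypothesis \<open>mult\<close> hands
  this bound back to \<xi> at the price of \<open>k\<^sup>2\<close>, which is of order
  \<open>1 / \<xi>\<^sup>2\<close>.\<close>

lemma quadratic_lower_bound:
  fixes S :: "real \<Rightarrow> real"
  assumes nonneg: "\<And>\<xi>. 0 \<le> S \<xi>"
    and lsc: "\<And>t. open {\<xi>. t < S \<xi>}"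
    and mult: "\<And>k \<xi>. S (of_int k * \<xi>) \<le> (of_int k)\<^sup>2 * S \<xi>"
    and pos: "0 < S \<xi>0"
  shows "\<exists>\<kappa>>0. \<exists>\<delta>>0. \<forall>\<xi>. \<bar>\<xi>\<bar> < \<delta> \<longrightarrow> \<kappa> * \<xi>\<^sup>2 \<le> S \<xi>"
proof -
  \<comment> \<open>With \<open>k = 0\<close>, \<open>mult\<close> forces
    \<open>S 0 \<le> 0\<close>.\<close>
  have "\<xi>0 \<noteq> 0" using mult[of 0 0] pos by auto
  have "open {\<xi>. S \<xi>0 / 2 < S \<xi>}" "\<xi>0 \<in> {\<xi>. S \<xi>0 / 2 < S \<xi>}" using lsc[of "S \<xi>0 / 2"] pos by simp_all
  then obtain e where e: "0 < e" "ball \<xi>0 e \<subseteq> {\<xi>. S \<xi>0 / 2 < S \<xi>}"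
    unfolding open_contains_ball by blast
  \<comment> \<open>The 8 is the 2 of \<open>S \<xi>0 / 2\<close> times the 4 obtained by squaring
    \<open>\<bar>k * \<xi>\<bar> \<le> 2 * \<bar>\<xi>0\<bar>\<close>.\<close>
  define \<kappa> where "\<kappa> = S \<xi>0 / (8 * \<xi>0\<^sup>2)"
  have "\<kappa> * \<xi>\<^sup>2 \<le> S \<xi>" if \<xi>: "\<bar>\<xi>\<bar> < min e \<bar>\<xi>0\<bar>" for \<xi>
  proof (cases "\<xi> = 0")
    case True
    then show ?thesis using nonneg by simp
  next
    case False
    define k where "k = \<lfloor>\<xi>0 / \<xi>\<rfloor>"
    have "\<bar>\<xi>0 / \<xi> - of_int k\<bar> \<le> 1" unfolding k_def by linarith
    then have "\<bar>\<xi>\<bar> * \<bar>\<xi>0 / \<xi> - of_int k\<bar> \<le> \<bar>\<xi>\<bar>" by (simp add: mult_left_le)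
    then have dist: "\<bar>\<xi>0 - of_int k * \<xi>\<bar> \<le> \<bar>\<xi>\<bar>"
      unfolding abs_mult[symmetric] using False by (simp add: right_diff_distrib mult.commute)
    then have "of_int k * \<xi> \<in> ball \<xi>0 e" using \<xi> by (simp add: dist_real_def)
    then have "S \<xi>0 / 2 \<le> S (of_int k * \<xi>)" using e(2) by auto
    then have 1: "S \<xi>0 / 2 \<le> (of_int k)\<^sup>2 * S \<xi>" using mult[of k \<xi>] by simp
    have "\<bar>of_int k * \<xi>\<bar> \<le> \<bar>2 * \<xi>0\<bar>" using dist \<xi> by linarith
    then have "(of_int k * \<xi>)\<^sup>2 \<le> (2 * \<xi>0)\<^sup>2" by (simp only: abs_le_square_iff)
    then have "(of_int k)\<^sup>2 * \<xi>\<^sup>2 \<le> 4 * \<xi>0\<^sup>2" by (simp add: power_mult_distrib)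
    then have "(of_int k)\<^sup>2 * \<xi>\<^sup>2 * S \<xi> \<le> 4 * \<xi>0\<^sup>2 * S \<xi>"
      using nonneg by (intro mult_right_mono) auto
    moreover have "S \<xi>0 / 2 * \<xi>\<^sup>2 \<le> (of_int k)\<^sup>2 * S \<xi> * \<xi>\<^sup>2"
      using 1 by (intro mult_right_mono) auto
    ultimately have "S \<xi>0 / 2 * \<xi>\<^sup>2 \<le> 4 * \<xi>0\<^sup>2 * S \<xi>" by (simp add: ac_simps)
    then show ?thesis using \<open>\<xi>0 \<noteq> 0\<close> by (simp add: \<kappa>_def field_simps)
  qed
  moreover have "0 < \<kappa>" "0 < min e \<bar>\<xi>0\<bar>" using pos \<open>\<xi>0 \<noteq> 0\<close> e by (auto simp: \<kappa>_def)
  ultimately show ?thesis by blast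
qed

text \<open>The measure with density \<open>1 / S\<close> is locally finite, and finitely many balls
  of finite mass cover \<open>cball 0 r\<close>. Where \<open>S\<close> is positive, lower
  semicontinuity bounds the density; at a zero of \<open>S\<close> the ball is compared with its
  translate at the origin.\<close>

lemma nn_integral_inverse_finite_of_near_zero:
  fixes S :: "real \<Rightarrow> real"
  assumes nonneg: "\<And>\<xi>. 0 \<le> S \<xi>"
    and lsc: "\<And>t. open {\<xi>. t < S \<xi>}"
    and tri: "\<And>\<xi> \<eta>. S (\<xi> - \<eta>) \<le> 2 * S \<xi> + 2 * S \<eta>"
    and \<delta>: "0 < \<delta>" "(\<integral>\<^sup>+ \<xi>\<in>{\<xi>. \<bar>\<xi>\<bar> < \<delta>}. 1 / ennreal (S \<xi>) \<partial>lborel) < \<infinity>"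
  shows "(\<integral>\<^sup>+ \<xi>\<in>{\<xi>. \<bar>\<xi>\<bar> < r}. 1 / ennreal (S \<xi>) \<partial>lborel) < \<infinity>"
proof -
  have [measurable]: "S \<in> borel_measurable borel"
    by (rule borel_measurable_of_open_superlevel[OF lsc])
  define M where "M = density lborel (\<lambda>\<xi>. 1 / ennreal (S \<xi>))"
  have M: "emeasure M A = (\<integral>\<^sup>+ \<xi>\<in>A. 1 / ennreal (S \<xi>) \<partial>lborel)" if "A \<in> sets borel" for A
    unfolding M_def using that by (simp add: emeasure_density)
  have sets_M: "sets M = sets borel" by (simp add: M_def)
  have ball0: "{\<xi>. \<bar>\<xi>\<bar> < s} = ball 0 s" for s :: real
    by (auto simp: dist_real_def)
  have local: "\<exists>e>0. emeasure M (ball \<xi>0 e) < \<infinity>" for \<xi>0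
  proof (cases "S \<xi>0 = 0")
    case True
    have "emeasure M (ball \<xi>0 \<delta>) = (\<integral>\<^sup>+ \<xi>. 1 / ennreal (S (\<xi>0 + \<xi>)) * indicator (ball \<xi>0 \<delta>) (\<xi>0 + \<xi>) \<partial>lborel)"
      unfolding M[OF borel_open[OF open_ball]]
      by (subst nn_integral_real_affine[where c = 1 and t = \<xi>0]) (measurable, simp_all)
    also have "\<dots> \<le> (\<integral>\<^sup>+ \<xi>. ennreal 2 * (1 / ennreal (S \<xi>) * indicator (ball 0 \<delta>) \<xi>) \<partial>lborel)"
    proof (intro nn_integral_mono)
      fix \<xi> :: real
      \<comment> \<open>The term \<open>2 * S \<xi>0\<close> in \<open>tri\<close> vanishes, so the
        density at \<open>\<xi>0 + \<xi>\<close> is at most twice the density at \<xi>.\<close>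
      have "S \<xi> \<le> 2 * S (\<xi>0 + \<xi>)" using tri[of "\<xi>0 + \<xi>" \<xi>0] True by simp
      then have "1 / ennreal (S (\<xi>0 + \<xi>)) \<le> ennreal 2 * (1 / ennreal (S \<xi>))"
        by (intro inverse_le_ennreal nonneg) auto
      then show "1 / ennreal (S (\<xi>0 + \<xi>)) * indicator (ball \<xi>0 \<delta>) (\<xi>0 + \<xi>)
          \<le> ennreal 2 * (1 / ennreal (S \<xi>) * indicator (ball 0 \<delta>) \<xi>)"
        by (auto split: split_indicator simp: dist_real_def)
    qed
    also have "\<dots> < \<infinity>"
      using \<delta>(2) by (simp add: nn_integral_cmult ball0 ennreal_mult_less_top)
    finally show ?thesis using \<delta>(1) by blast
  next
    case False
    then have pos: "0 < S \<xi>0" using nonneg[of \<xi>0] by simp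
    then have "open {\<xi>. S \<xi>0 / 2 < S \<xi>}" "\<xi>0 \<in> {\<xi>. S \<xi>0 / 2 < S \<xi>}" using lsc[of "S \<xi>0 / 2"] by simp_all
    then obtain e where e: "0 < e" "ball \<xi>0 e \<subseteq> {\<xi>. S \<xi>0 / 2 < S \<xi>}"
      unfolding open_contains_ball by blast
    have "emeasure M (ball \<xi>0 e) \<le> (\<integral>\<^sup>+ \<xi>. ennreal (2 / S \<xi>0) * indicator (ball \<xi>0 e) \<xi> \<partial>lborel)"
      unfolding M[OF borel_open[OF open_ball]]
    proof (intro nn_integral_mono)
      fix \<xi>
      show "1 / ennreal (S \<xi>) * indicator (ball \<xi>0 e) \<xi> \<le> ennreal (2 / S \<xi>0) * indicator (ball \<xi>0 e) \<xi>"
      proof (cases "\<xi> \<in> ball \<xi>0 e")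
        case True
        then have "1 \<le> 2 / S \<xi>0 * S \<xi>" using e pos by (auto simp: field_simps)
        then have "1 / ennreal (S \<xi>) \<le> ennreal (2 / S \<xi>0) * (1 / ennreal 1)"
          using pos by (intro inverse_le_ennreal nonneg) auto
        then show ?thesis using True by simp
      qed simp
    qed
    also have "\<dots> = ennreal (2 / S \<xi>0) * emeasure lborel (ball \<xi>0 e)"
      by (simp add: nn_integral_cmult_indicator)
    also have "\<dots> < \<infinity>"
      using emeasure_lborel_ball_finite[of \<xi>0 e] by (simp add: ennreal_mult_less_top)
    finally show ?thesis using e(1) by blast
  qed
  then obtain e where e: "\<And>\<xi>. 0 < e \<xi>" "\<And>\<xi>. emeasure M (ball \<xi> (e \<xi>)) < \<infinity>" by metis
  have cover: "cball 0 r \<subseteq> (\<Union>\<xi>\<in>cball 0 r. ball \<xi> (e \<xi>))"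
    using e(1) by (auto intro!: bexI)
  obtain T where T: "T \<subseteq> cball 0 r" "finite T" "cball 0 r \<subseteq> (\<Union>\<xi>\<in>T. ball \<xi> (e \<xi>))"
    by (rule compactE_image[OF compact_cball _ cover]) auto
  have "emeasure M (ball 0 r) \<le> emeasure M (\<Union>\<xi>\<in>T. ball \<xi> (e \<xi>))"
    using T(2,3) by (intro emeasure_mono) (auto simp: sets_M intro!: sets.finite_UN)
  also have "\<dots> \<le> (\<Sum>\<xi>\<in>T. emeasure M (ball \<xi> (e \<xi>)))"
    using T(2) by (intro emeasure_subadditive_finite) (auto simp: sets_M)
  also have "\<dots> < \<infinity>" using e(2) T(2) by (simp add: less_top)
  finally show ?thesis by (simp add: M ball0)
qed

text \<open>On \<open>(0, 1 / m)\<close> the integrand is at least \<open>m\<^sup>2 / K\<close>, so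
  the integral is at least \<open>m / K\<close> for every positive integer \<open>m\<close>.\<close>

lemma nn_integral_inverse_square_infinite:
  assumes "0 < K"
  shows "(\<integral>\<^sup>+ \<xi>\<in>{\<xi>. \<bar>\<xi>\<bar> < 1}. 1 / ennreal (K * \<xi>\<^sup>2) \<partial>lborel) = \<infinity>"
proof -
  let ?I = "\<integral>\<^sup>+ \<xi>\<in>{\<xi>. \<bar>\<xi>\<bar> < 1}. 1 / ennreal (K * \<xi>\<^sup>2) \<partial>lborel"
  have ge: "ennreal (real (Suc n) / K) \<le> ?I" for n
  proof -
    define m where "m = real (Suc n)"
    have m: "1 \<le> m" by (simp add: m_def)
    have "ennreal (m / K) = ennreal (m\<^sup>2 / K) * emeasure lborel {0<..<1 / m}"
    proof -
      have "m / K = m\<^sup>2 / K * (1 / m)" using m by (simp add: power2_eq_square)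
      then have "ennreal (m / K) = ennreal (m\<^sup>2 / K) * ennreal (1 / m)"
        using assms m by (subst ennreal_mult[symmetric]) auto
      then show ?thesis using m by simp
    qed
    also have "\<dots> = (\<integral>\<^sup>+ \<xi>. ennreal (m\<^sup>2 / K) * indicator {0<..<1 / m} \<xi> \<partial>lborel)"
      by (simp add: nn_integral_cmult_indicator)
    also have "\<dots> \<le> ?I"
    proof (intro nn_integral_mono)
      fix \<xi> :: real
      show "ennreal (m\<^sup>2 / K) * indicator {0<..<1 / m} \<xi>
          \<le> 1 / ennreal (K * \<xi>\<^sup>2) * indicator {\<xi>. \<bar>\<xi>\<bar> < 1} \<xi>"
      proof (cases "\<xi> \<in> {0<..<1 / m}")
        case True
        then have \<xi>: "0 < \<xi>" "\<xi> * m < 1" using m by (auto simp: field_simps)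
        have "\<xi> \<le> \<xi> * m" using m \<xi> by simp
        then have "\<xi> < 1" using \<xi> by linarith
        have "(\<xi> * m)\<^sup>2 \<le> 1" using \<xi> m by (simp add: power_le_one)
        then have "m\<^sup>2 / K \<le> 1 / (K * \<xi>\<^sup>2)"
          using \<xi> assms mult_right_mono[of "(\<xi> * m)\<^sup>2" 1 "1 / (K * \<xi>\<^sup>2)"]
          by (simp add: power_mult_distrib)
        then have "ennreal (m\<^sup>2 / K) \<le> ennreal (1 / (K * \<xi>\<^sup>2))" by (rule ennreal_leI)
        also have "\<dots> = 1 / ennreal (K * \<xi>\<^sup>2)"
          using \<xi> assms divide_ennreal[of 1 "K * \<xi>\<^sup>2"] by simp
        finally show ?thesis using True \<open>\<xi> < 1\<close> by simp
      qed simp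
    qed
    finally show ?thesis by (simp add: m_def)
  qed
  show ?thesis
  proof (cases ?I)
    case (real R)
    obtain n where "R * K < real n" using reals_Archimedean2 by blast
    then have "R < real (Suc n) / K" using assms by (simp add: field_simps)
    moreover have "real (Suc n) / K \<le> R" using ge[of n] real by simp
    ultimately show ?thesis by simp
  qed simp
qed

lemma infinite_integral_transfer:
  fixes S\<^sub>1 S\<^sub>2 :: "real \<Rightarrow> real"
  assumes nonneg: "\<And>\<xi>. 0 \<le> S\<^sub>1 \<xi>" "\<And>\<xi>. 0 \<le> S\<^sub>2 \<xi>"
    and lsc: "\<And>t. open {\<xi>. t < S\<^sub>1 \<xi>}" "\<And>t. open {\<xi>. t < S\<^sub>2 \<xi>}"
    and tri: "\<And>\<xi> \<eta>. S\<^sub>1 (\<xi> - \<eta>) \<le> 2 * S\<^sub>1 \<xi> + 2 * S\<^sub>1 \<eta>"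
    and mult: "\<And>k \<xi>. S\<^sub>1 (of_int k * \<xi>) \<le> (of_int k)\<^sup>2 * S\<^sub>1 \<xi>"
    and K: "0 < K" "\<And>\<xi>. S\<^sub>2 \<xi> \<le> S\<^sub>1 \<xi> + K * \<xi>\<^sup>2"
    and inf: "(\<integral>\<^sup>+ \<xi>\<in>{\<xi>. \<bar>\<xi>\<bar> < r}. 1 / ennreal (S\<^sub>1 \<xi>) \<partial>lborel) = \<infinity>"
  shows "\<exists>r>0. (\<integral>\<^sup>+ \<xi>\<in>{\<xi>. \<bar>\<xi>\<bar> < r}. 1 / ennreal (S\<^sub>2 \<xi>) \<partial>lborel) = \<infinity>"
proof (cases "\<exists>\<xi>0. 0 < S\<^sub>1 \<xi>0")
  case True
  then obtain \<kappa> \<delta> where \<kappa>: "0 < \<kappa>" "0 < \<delta>" "\<And>\<xi>. \<bar>\<xi>\<bar> < \<delta> \<Longrightarrow> \<kappa> * \<xi>\<^sup>2 \<le> S\<^sub>1 \<xi>"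
    using quadratic_lower_bound[of S\<^sub>1] nonneg(1) lsc(1) mult by metis
  have [measurable]: "S\<^sub>2 \<in> borel_measurable borel"
    by (rule borel_measurable_of_open_superlevel[OF lsc(2)])
  \<comment> \<open>Near the origin \<open>K * \<xi>\<^sup>2 = (K / \<kappa>) * (\<kappa> *
    \<xi>\<^sup>2) \<le> (K / \<kappa>) * S\<^sub>1 \<xi>\<close>.\<close>
  define C where "C = 1 + K / \<kappa>"
  have C: "0 < C" using \<kappa> K by (simp add: C_def add_pos_pos)
  have "(\<integral>\<^sup>+ \<xi>\<in>{\<xi>. \<bar>\<xi>\<bar> < \<delta>}. 1 / ennreal (S\<^sub>1 \<xi>) \<partial>lborel)
      \<le> (\<integral>\<^sup>+ \<xi>. ennreal C * (1 / ennreal (S\<^sub>2 \<xi>) * indicator {\<xi>. \<bar>\<xi>\<bar> < \<delta>} \<xi>) \<partial>lborel)"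
  proof (intro nn_integral_mono)
    fix \<xi>
    show "1 / ennreal (S\<^sub>1 \<xi>) * indicator {\<xi>. \<bar>\<xi>\<bar> < \<delta>} \<xi>
        \<le> ennreal C * (1 / ennreal (S\<^sub>2 \<xi>) * indicator {\<xi>. \<bar>\<xi>\<bar> < \<delta>} \<xi>)"
    proof (cases "\<bar>\<xi>\<bar> < \<delta>")
      case True
      have "K / \<kappa> * (\<kappa> * \<xi>\<^sup>2) \<le> K / \<kappa> * S\<^sub>1 \<xi>"
        using \<kappa>(1) K(1) by (intro mult_left_mono \<kappa>(3) True) auto
      then have "S\<^sub>2 \<xi> \<le> C * S\<^sub>1 \<xi>"
        using K(2)[of \<xi>] \<kappa>(1) by (simp add: C_def distrib_right)
      then have "1 / ennreal (S\<^sub>1 \<xi>) \<le> ennreal C * (1 / ennreal (S\<^sub>2 \<xi>))"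
        by (intro inverse_le_ennreal nonneg C)
      then show ?thesis using True by simp
    qed simp
  qed
  also have "\<dots> = ennreal C * (\<integral>\<^sup>+ \<xi>\<in>{\<xi>. \<bar>\<xi>\<bar> < \<delta>}. 1 / ennreal (S\<^sub>2 \<xi>) \<partial>lborel)"
    by (intro nn_integral_cmult) measurable
  finally have le: "(\<integral>\<^sup>+ \<xi>\<in>{\<xi>. \<bar>\<xi>\<bar> < \<delta>}. 1 / ennreal (S\<^sub>1 \<xi>) \<partial>lborel)
    \<le> ennreal C * (\<integral>\<^sup>+ \<xi>\<in>{\<xi>. \<bar>\<xi>\<bar> < \<delta>}. 1 / ennreal (S\<^sub>2 \<xi>) \<partial>lborel)" .
  have "(\<integral>\<^sup>+ \<xi>\<in>{\<xi>. \<bar>\<xi>\<bar> < \<delta>}. 1 / ennreal (S\<^sub>2 \<xi>) \<partial>lborel) = \<infinity>"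
  \<comment> \<open>The comparison holds only within radius \<delta>, the divergence is given within
    radius \<open>r\<close>: finiteness near the origin would spread to \<open>r\<close>.\<close>
  proof (rule ccontr)
    assume "(\<integral>\<^sup>+ \<xi>\<in>{\<xi>. \<bar>\<xi>\<bar> < \<delta>}. 1 / ennreal (S\<^sub>2 \<xi>) \<partial>lborel) \<noteq> \<infinity>"
    then have "ennreal C * (\<integral>\<^sup>+ \<xi>\<in>{\<xi>. \<bar>\<xi>\<bar> < \<delta>}. 1 / ennreal (S\<^sub>2 \<xi>) \<partial>lborel) < \<infinity>"
      by (simp add: ennreal_mult_less_top less_top)
    with le have "(\<integral>\<^sup>+ \<xi>\<in>{\<xi>. \<bar>\<xi>\<bar> < \<delta>}. 1 / ennreal (S\<^sub>1 \<xi>) \<partial>lborel) < \<infinity>"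
      by (rule le_less_trans)
    with nonneg(1) lsc(1) tri \<kappa>(2)
    have "(\<integral>\<^sup>+ \<xi>\<in>{\<xi>. \<bar>\<xi>\<bar> < r}. 1 / ennreal (S\<^sub>1 \<xi>) \<partial>lborel) < \<infinity>"
      by (rule nn_integral_inverse_finite_of_near_zero)
    then show False using inf by simp
  qed
  then show ?thesis using \<kappa>(2) by blast
next
  case False
  \<comment> \<open>Now \<open>S\<^sub>2 \<xi> \<le> K * \<xi>\<^sup>2\<close>, whose reciprocal is
    not integrable at the origin.\<close>
  then have S1: "S\<^sub>1 \<xi> = 0" for \<xi> using nonneg(1)[of \<xi>] by (meson not_less order.antisym)
  have "(\<integral>\<^sup>+ \<xi>\<in>{\<xi>. \<bar>\<xi>\<bar> < 1}. 1 / ennreal (K * \<xi>\<^sup>2) \<partial>lborel)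
      \<le> (\<integral>\<^sup>+ \<xi>\<in>{\<xi>. \<bar>\<xi>\<bar> < 1}. 1 / ennreal (S\<^sub>2 \<xi>) \<partial>lborel)"
  proof (intro nn_integral_mono mult_right_mono)
    fix \<xi>
    show "1 / ennreal (K * \<xi>\<^sup>2) \<le> 1 / ennreal (S\<^sub>2 \<xi>)"
      using inverse_le_ennreal[of "S\<^sub>2 \<xi>" "K * \<xi>\<^sup>2" 1] K nonneg(2)[of \<xi>] S1[of \<xi>]
      by (metis add_0 ennreal_1 less_eq_real_def mult_1 mult_nonneg_nonneg zero_le_power2 zero_less_one)
  qed simp
  then show ?thesis
    using nn_integral_inverse_square_infinite[OF K(1)] by (metis infinity_ennreal_def top.extremum_uniqueI zero_less_one)
qed

lemma finite_integral_transfer: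
  fixes L\<^sub>1 L\<^sub>2 :: "real \<Rightarrow> real"
  assumes nonneg: "\<And>\<xi>. 0 \<le> L\<^sub>1 \<xi>" "\<And>\<xi>. 0 \<le> L\<^sub>2 \<xi>"
    and meas [measurable]: "L\<^sub>1 \<in> borel_measurable borel"
    and K: "0 < K" "\<And>\<xi>. L\<^sub>1 \<xi> \<le> L\<^sub>2 \<xi> + K * \<xi>\<^sup>2"
    and r: "0 < r" "(\<integral>\<^sup>+ \<xi>\<in>{\<xi>. \<bar>\<xi>\<bar> < r}. 1 / ennreal (L\<^sub>1 \<xi>) \<partial>lborel) < \<infinity>"
    and lim: "filterlim (\<lambda>\<xi>. L\<^sub>1 \<xi> / \<xi>\<^sup>2) at_top (at 0)"
  shows "\<exists>r>0. (\<integral>\<^sup>+ \<xi>\<in>{\<xi>. \<bar>\<xi>\<bar> < r}. 1 / ennreal (L\<^sub>2 \<xi>) \<partial>lborel) < \<infinity>"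
    and "filterlim (\<lambda>\<xi>. L\<^sub>2 \<xi> / \<xi>\<^sup>2) at_top (at 0)"
proof -
  show "filterlim (\<lambda>\<xi>. L\<^sub>2 \<xi> / \<xi>\<^sup>2) at_top (at 0)"
  proof (rule filterlim_at_top_mono)
    show "filterlim (\<lambda>\<xi>. - K + L\<^sub>1 \<xi> / \<xi>\<^sup>2) at_top (at 0)"
      using tendsto_const lim by (rule filterlim_tendsto_add_at_top)
    have "- K + L\<^sub>1 \<xi> / \<xi>\<^sup>2 \<le> L\<^sub>2 \<xi> / \<xi>\<^sup>2" if "\<xi> \<noteq> 0" for \<xi>
      using divide_right_mono[OF K(2)[of \<xi>], of "\<xi>\<^sup>2"] that by (simp add: add_divide_distrib)
    then show "\<forall>\<^sub>F \<xi> in at 0. - K + L\<^sub>1 \<xi> / \<xi>\<^sup>2 \<le> L\<^sub>2 \<xi> / \<xi>\<^sup>2"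
      by (simp add: eventually_at_filter)
  qed
  \<comment> \<open>The threshold \<open>2 * K\<close> makes \<open>K * \<xi>\<^sup>2\<close> at
    most half of \<open>L\<^sub>1 \<xi>\<close>, which leaves
    \<open>L\<^sub>1 \<xi> \<le> 2 * L\<^sub>2 \<xi>\<close>.\<close>
  have "\<forall>\<^sub>F \<xi> in at 0. 2 * K \<le> L\<^sub>1 \<xi> / \<xi>\<^sup>2"
    using lim unfolding filterlim_at_top by blast
  then obtain d where d: "0 < d" "\<And>\<xi>. \<xi> \<noteq> 0 \<Longrightarrow> \<bar>\<xi>\<bar> < d \<Longrightarrow> 2 * K \<le> L\<^sub>1 \<xi> / \<xi>\<^sup>2"
    unfolding eventually_at by (auto simp: dist_real_def)
  define s where "s = min d r"
  have "(\<integral>\<^sup>+ \<xi>\<in>{\<xi>. \<bar>\<xi>\<bar> < s}. 1 / ennreal (L\<^sub>2 \<xi>) \<partial>lborel)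
      \<le> (\<integral>\<^sup>+ \<xi>. ennreal 2 * (1 / ennreal (L\<^sub>1 \<xi>) * indicator {\<xi>. \<bar>\<xi>\<bar> < r} \<xi>) \<partial>lborel)"
  proof (rule nn_integral_mono_AE)
    show "AE \<xi> in lborel. 1 / ennreal (L\<^sub>2 \<xi>) * indicator {\<xi>. \<bar>\<xi>\<bar> < s} \<xi>
        \<le> ennreal 2 * (1 / ennreal (L\<^sub>1 \<xi>) * indicator {\<xi>. \<bar>\<xi>\<bar> < r} \<xi>)"
      \<comment> \<open>The origin is discarded, since the limit says nothing about the value
        there.\<close>
      using AE_lborel_singleton[of 0]
    proof eventually_elim
      case (elim \<xi>)
      show ?case
      proof (cases "\<bar>\<xi>\<bar> < s")
        case True
        then have "2 * K \<le> L\<^sub>1 \<xi> / \<xi>\<^sup>2" using elim by (intro d) (auto simp: s_def)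
        then have "2 * K * \<xi>\<^sup>2 \<le> L\<^sub>1 \<xi>" using elim by (simp add: pos_le_divide_eq)
        then have "L\<^sub>1 \<xi> \<le> 2 * L\<^sub>2 \<xi>" using K(2)[of \<xi>] by linarith
        then have "1 / ennreal (L\<^sub>2 \<xi>) \<le> ennreal 2 * (1 / ennreal (L\<^sub>1 \<xi>))"
          by (intro inverse_le_ennreal nonneg) auto
        then show ?thesis using True by (simp add: s_def)
      qed simp
    qed
  qed
  also have "\<dots> = ennreal 2 * (\<integral>\<^sup>+ \<xi>\<in>{\<xi>. \<bar>\<xi>\<bar> < r}. 1 / ennreal (L\<^sub>1 \<xi>) \<partial>lborel)"
    by (intro nn_integral_cmult) measurable
  also have "\<dots> < \<infinity>" using r(2) by (simp add: ennreal_mult_less_top)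
  finally show "\<exists>r>0. (\<integral>\<^sup>+ \<xi>\<in>{\<xi>. \<bar>\<xi>\<bar> < r}. 1 / ennreal (L\<^sub>2 \<xi>) \<partial>lborel) < \<infinity>"
    using d(1) r(1) by (intro exI[of _ s]) (simp add: s_def)
qed

section \<open>Levy measures on the real line\<close>

text \<open>By the addition formula each step adds at most one \<open>\<bar>sin t\<bar>\<close>;
  negative integers follow because the sine is odd.\<close>

lemma abs_sin_of_int_mult_le: "\<bar>sin (of_int k * t)\<bar> \<le> \<bar>of_int k\<bar> * \<bar>sin t\<bar>" for t :: real
proof -
  have nat: "\<bar>sin (real n * t)\<bar> \<le> real n * \<bar>sin t\<bar>" for n
  proof (induction n)
    case (Suc n)
    have "\<bar>sin (real (Suc n) * t)\<bar> = \<bar>sin (real n * t) * cos t + cos (real n * t) * sin t\<bar>"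
      by (simp add: distrib_right sin_add algebra_simps)
    also have "\<dots> \<le> \<bar>sin (real n * t)\<bar> * \<bar>cos t\<bar> + \<bar>cos (real n * t)\<bar> * \<bar>sin t\<bar>"
      by (metis abs_mult abs_triangle_ineq)
    also have "\<dots> \<le> \<bar>sin (real n * t)\<bar> * 1 + 1 * \<bar>sin t\<bar>"
      by (intro add_mono mult_left_mono mult_right_mono) auto
    finally show ?case using Suc by (simp add: distrib_right)
  qed simp
  obtain n where "k = int n \<or> k = - int n" by (metis int_cases2)
  then show ?thesis using nat[of n] by auto
qed

text \<open>The square of the preceding bound at the half angle. Integrated, it becomes the scaling
  hypothesis \<open>mult\<close> for the suprema of the symbols.\<close>

lemma one_minus_cos_of_int_mult_le: "1 - cos (of_int k * t) \<le> (of_int k)\<^sup>2 * (1 - cos t)" for t :: real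
proof -
  have *: "1 - cos s = 2 * (sin (s / 2))\<^sup>2" for s :: real
    using cos_double_sin[of "s / 2"] by simp
  have "(sin (of_int k * (t / 2)))\<^sup>2 \<le> (of_int k)\<^sup>2 * (sin (t / 2))\<^sup>2"
    using power_mono[OF abs_sin_of_int_mult_le[of k "t / 2"], of 2] by (simp add: power_mult_distrib)
  then show ?thesis by (simp add: *)
qed

text \<open>The square root of \<open>1 - cos s\<close> is a multiple of
  \<open>\<bar>sin (s / 2)\<bar>\<close>, which is subadditive; the factors 2 come from
  \<open>(u + v)\<^sup>2 \<le> 2 * u\<^sup>2 + 2 * v\<^sup>2\<close>. Integrated, it becomes the
  hypothesis \<open>tri\<close>.\<close>

lemma one_minus_cos_diff_le: "1 - cos (s - t) \<le> 2 * (1 - cos s) + 2 * (1 - cos t)" for s t :: real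
proof -
  have *: "1 - cos s = 2 * (sin (s / 2))\<^sup>2" for s :: real
    using cos_double_sin[of "s / 2"] by simp
  have "\<bar>sin (s / 2 - t / 2)\<bar> \<le> \<bar>sin (s / 2)\<bar> * \<bar>cos (t / 2)\<bar> + \<bar>cos (s / 2)\<bar> * \<bar>sin (t / 2)\<bar>"
    unfolding sin_diff abs_mult[symmetric] by linarith
  also have "\<dots> \<le> \<bar>sin (s / 2)\<bar> * 1 + 1 * \<bar>sin (t / 2)\<bar>"
    by (intro add_mono mult_left_mono mult_right_mono) auto
  finally have "\<bar>sin ((s - t) / 2)\<bar> \<le> \<bar>sin (s / 2)\<bar> + \<bar>sin (t / 2)\<bar>"
    by (simp add: diff_divide_distrib)
  from power_mono[OF this, of 2]
  have "(sin ((s - t) / 2))\<^sup>2 \<le> (\<bar>sin (s / 2)\<bar> + \<bar>sin (t / 2)\<bar>)\<^sup>2" by simp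
  also have "\<dots> \<le> 2 * (sin (s / 2))\<^sup>2 + 2 * (sin (t / 2))\<^sup>2"
    using sum_squares_bound[of "\<bar>sin (s / 2)\<bar>" "\<bar>sin (t / 2)\<bar>"] by (simp add: power2_sum)
  finally show ?thesis by (simp add: *)
qed

lemma one_minus_cos_le: "1 - cos t \<le> t\<^sup>2 / 2" for t :: real
proof -
  have "1 - cos t = 2 * (sin (t / 2))\<^sup>2"
    using cos_double_sin[of "t / 2"] by simp
  also have "\<dots> \<le> 2 * \<bar>t / 2\<bar>\<^sup>2"
    using power_mono[OF abs_sin_x_le_abs_x[of "t / 2"], of 2] by simp
  finally show ?thesis by (simp add: power_divide)
qed

section \<open>A single Levy measure and its cosine exponent\<close>

locale levy_measure =
  fixes N :: "real measure"
  assumes sets_N [simp, measurable_cong]: "sets N = sets borel"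
    and min_finite: "(\<integral>\<^sup>+ y. ennreal (min 1 (y\<^sup>2)) \<partial>N) < \<infinity>"
begin

lemma space_N [simp]: "space N = UNIV"
  using sets_eq_imp_space_eq[OF sets_N] by simp

lemma integrable_min: "integrable N (\<lambda>y. min 1 (y\<^sup>2))"
  using min_finite by (intro integrableI_nonneg) auto

lemma integrable_dominated:
  fixes f :: "real \<Rightarrow> 'b::{banach, second_countable_topology}"
  assumes "f \<in> borel_measurable borel" "\<And>y. norm (f y) \<le> C * min 1 (y\<^sup>2)"
  shows "integrable N f"
proof (rule Bochner_Integration.integrable_bound)
  show "integrable N (\<lambda>y. C * min 1 (y\<^sup>2))" by (intro integrable_mult_right integrable_min)
  show "f \<in> borel_measurable N" using assms(1) by (simp add: measurable_cong_sets[OF sets_N refl])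
  show "AE y in N. norm (f y) \<le> norm (C * min 1 (y\<^sup>2))"
    using assms(2) by (intro AE_I2) (smt (verit) real_norm_def)
qed

text \<open>By Markov's inequality. These sets exhaust the punctured line and serve as the sets of
  finite mass on which two Levy measures can be subtracted.\<close>

lemma emeasure_away_from_zero_finite: "emeasure N {y. 1 / real (Suc n) \<le> min 1 (y\<^sup>2)} < \<infinity>"
proof -
  have "emeasure N {y. 1 / real (Suc n) \<le> min 1 (y\<^sup>2)}
      \<le> emeasure N ({y\<in>UNIV. 1 \<le> ennreal (real (Suc n)) * ennreal (min 1 (y\<^sup>2))})"
  proof (intro emeasure_mono subsetI)
    fix y :: real assume "y \<in> {y. 1 / real (Suc n) \<le> min 1 (y\<^sup>2)}"
    then have "1 \<le> real (Suc n) * min 1 (y\<^sup>2)" by (simp add: field_simps)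
    then have "ennreal 1 \<le> ennreal (real (Suc n) * min 1 (y\<^sup>2))" by (rule ennreal_leI)
    then show "y \<in> {y\<in>UNIV. 1 \<le> ennreal (real (Suc n)) * ennreal (min 1 (y\<^sup>2))}"
      by (simp add: ennreal_mult del: of_nat_Suc)
  qed measurable
  also have "\<dots> \<le> ennreal (real (Suc n)) * (\<integral>\<^sup>+ y. ennreal (min 1 (y\<^sup>2)) * indicator UNIV y \<partial>N)"
    by (intro nn_integral_Markov_inequality) auto
  also have "\<dots> < \<infinity>"
    using min_finite by (simp add: ennreal_mult_less_top del: of_nat_Suc)
  finally show ?thesis .
qed

text \<open>The constant serves two regimes: the bound 2 for large \<open>y\<close>, and the
  quadratic bound \<open>(\<xi> * y)\<^sup>2 / 2\<close> for small \<open>y\<close>.\<close>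

lemma one_minus_cos_le_min: "1 - cos (\<xi> * y) \<le> (2 + \<xi>\<^sup>2) * min 1 (y\<^sup>2)" for \<xi> y :: real
proof (cases "y\<^sup>2 \<le> 1")
  case True
  have "(\<xi> * y)\<^sup>2 / 2 \<le> (2 + \<xi>\<^sup>2) * y\<^sup>2"
    by (simp add: power_mult_distrib algebra_simps)
  then show ?thesis using one_minus_cos_le[of "\<xi> * y"] True by simp
next
  case False
  have "1 - cos (\<xi> * y) \<le> 2 + \<xi>\<^sup>2"
    using cos_ge_minus_one[of "\<xi> * y"] zero_le_power2[of \<xi>] by linarith
  then show ?thesis using False by simp
qed

lemma integrable_one_minus_cos: "integrable N (\<lambda>y. 1 - cos (\<xi> * y))"
  using one_minus_cos_le_min[of \<xi>]
  by (intro integrable_dominated[of _ "2 + \<xi>\<^sup>2"]) auto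

text \<open>The jump part of the real part of the symbol.\<close>

definition cos_exponent :: "real \<Rightarrow> real" where
  "cos_exponent \<xi> = (\<integral>y. (1 - cos (\<xi> * y)) \<partial>N)"

lemma cos_exponent_nonneg: "0 \<le> cos_exponent \<xi>"
  unfolding cos_exponent_def by (intro integral_nonneg_AE) auto

lemma cos_exponent_diff_le: "cos_exponent (\<xi> - \<eta>) \<le> 2 * cos_exponent \<xi> + 2 * cos_exponent \<eta>"
proof -
  have "cos_exponent (\<xi> - \<eta>) \<le> (\<integral>y. 2 * (1 - cos (\<xi> * y)) + 2 * (1 - cos (\<eta> * y)) \<partial>N)"
    unfolding cos_exponent_def
    by (intro integral_mono integrable_one_minus_cos Bochner_Integration.integrable_add integrable_mult_right)
       (use one_minus_cos_diff_le in \<open>simp add: left_diff_distrib\<close>)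
  also have "\<dots> = 2 * cos_exponent \<xi> + 2 * cos_exponent \<eta>"
    unfolding cos_exponent_def
    by (subst Bochner_Integration.integral_add)
       (auto intro!: integrable_mult_right integrable_one_minus_cos simp only: integral_mult_right_zero)
  finally show ?thesis .
qed

lemma cos_exponent_of_int_mult_le: "cos_exponent (of_int k * \<xi>) \<le> (of_int k)\<^sup>2 * cos_exponent \<xi>"
proof -
  have "cos_exponent (of_int k * \<xi>) \<le> (\<integral>y. (of_int k)\<^sup>2 * (1 - cos (\<xi> * y)) \<partial>N)"
    unfolding cos_exponent_def
    by (intro integral_mono integrable_one_minus_cos integrable_mult_right)
       (use one_minus_cos_of_int_mult_le in \<open>simp add: mult.assoc\<close>)
  then show ?thesis unfolding cos_exponent_def by (simp only: integral_mult_right_zero)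
qed

lemma continuous_cos_exponent: "continuous_on UNIV cos_exponent"
proof (rule continuous_at_imp_continuous_on, intro ballI)
  fix \<xi> :: real
  have "(\<lambda>n. cos_exponent (X n)) \<longlonglongrightarrow> cos_exponent \<xi>" if X: "X \<longlonglongrightarrow> \<xi>" for X
  proof -
    \<comment> \<open>A convergent sequence is bounded, which makes the dominating function
      independent of \<open>n\<close>.\<close>
    obtain K where K: "\<And>n. norm (X n) \<le> K"
      using convergent_imp_Bseq[OF convergentI[OF X]] unfolding Bseq_def by auto
    show ?thesis
      unfolding cos_exponent_def
    proof (rule integral_dominated_convergence)
      show "integrable N (\<lambda>y. (2 + K\<^sup>2) * min 1 (y\<^sup>2))"
        by (intro integrable_mult_right integrable_min)
      show "AE y in N. (\<lambda>n. 1 - cos (X n * y)) \<longlonglongrightarrow> 1 - cos (\<xi> * y)"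
        using X by (intro AE_I2 tendsto_intros)
      show "AE y in N. norm (1 - cos (X n * y)) \<le> (2 + K\<^sup>2) * min 1 (y\<^sup>2)" for n
      proof (intro AE_I2)
        fix y
        have "(X n)\<^sup>2 \<le> K\<^sup>2" using K[of n] by (simp add: abs_le_square_iff[symmetric])
        then have "(2 + (X n)\<^sup>2) * min 1 (y\<^sup>2) \<le> (2 + K\<^sup>2) * min 1 (y\<^sup>2)"
          by (intro mult_right_mono) auto
        then show "norm (1 - cos (X n * y)) \<le> (2 + K\<^sup>2) * min 1 (y\<^sup>2)"
          using one_minus_cos_le_min[of "X n" y] by simp
      qed
    qed (auto simp: measurable_cong_sets[OF sets_N refl])
  qed
  then show "isCont cos_exponent \<xi>"
    by (simp add: isCont_def tendsto_at_iff_sequentially continuous_at_sequentially o_def)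
qed

section \<open>The Levy-Khintchine integrand and symmetry of the Levy measure\<close>

definition levy_integrand :: "real \<Rightarrow> real \<Rightarrow> complex" where
  "levy_integrand \<xi> y =
     iexp (\<xi> * y) - 1 - \<i> * complex_of_real (\<xi> * y * indicator {y. \<bar>y\<bar> \<le> 1} y)"

text \<open>For \<open>\<bar>y\<bar> \<le> 1\<close> the compensated exponential is of second order
  by Taylor's formula; beyond, the compensator is absent and the modulus is at most 2.\<close>

lemma integrable_levy_integrand: "integrable N (levy_integrand \<xi>)"
proof (rule integrable_dominated)
  show "levy_integrand \<xi> \<in> borel_measurable borel"
    unfolding levy_integrand_def by measurable
  fix y :: real
  show "norm (levy_integrand \<xi> y) \<le> (2 + \<xi>\<^sup>2) * min 1 (y\<^sup>2)"
  proof (cases "\<bar>y\<bar> \<le> 1")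
    case True
    have "norm (levy_integrand \<xi> y) \<le> (\<xi> * y)\<^sup>2 / 2"
      using iexp_approx1[of "\<xi> * y" 1] True
      by (simp add: levy_integrand_def algebra_simps power2_eq_square)
    also have "\<dots> \<le> (2 + \<xi>\<^sup>2) * y\<^sup>2" by (simp add: power_mult_distrib algebra_simps)
    finally show ?thesis using True by (simp add: abs_square_le_1)
  next
    case False
    then have "levy_integrand \<xi> y = iexp (\<xi> * y) - 1" by (simp add: levy_integrand_def)
    then have "norm (levy_integrand \<xi> y) \<le> norm (iexp (\<xi> * y)) + norm (1::complex)"
      by (simp only: norm_triangle_ineq4)
    also have "\<dots> \<le> 2 + \<xi>\<^sup>2" by simp
    finally have "norm (levy_integrand \<xi> y) \<le> 2 + \<xi>\<^sup>2" .
    moreover have "min 1 (y\<^sup>2) = 1"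
      using False abs_square_less_1[of y] by (simp add: min_def)
    ultimately show ?thesis by simp
  qed
qed

lemma Re_levy_integral: "Re (\<integral>y. levy_integrand \<xi> y \<partial>N) = - cos_exponent \<xi>"
proof -
  have "Re (\<integral>y. levy_integrand \<xi> y \<partial>N) = (\<integral>y. - (1 - cos (\<xi> * y)) \<partial>N)"
    unfolding integral_Re[OF integrable_levy_integrand, symmetric]
    by (intro Bochner_Integration.integral_cong) (auto simp: levy_integrand_def Re_exp)
  also have "\<dots> = - cos_exponent \<xi>"
    unfolding cos_exponent_def by (simp only: integral_minus)
  finally show ?thesis .
qed

text \<open>
  If the odd part of the exponent is linear, then taking second differences in \<open>\<xi>\<close>
  shows that the finite measure \<open>(1 - cos (u * y)) N(dy)\<close> has a real characteristic function.
  So it is symmetric, and the two half-lines contribute equally to \<^term>\<open>cos_exponent u\<close>.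
\<close>

lemma nn_integral_negative_half:
  assumes linear: "\<And>\<xi>. Im (\<integral>y. levy_integrand \<xi> y \<partial>N) = \<beta> * \<xi>"
  shows "(\<integral>\<^sup>+ y\<in>{..<0}. ennreal (1 - cos (u * y)) \<partial>N) = (\<integral>\<^sup>+ y\<in>{0<..}. ennreal (1 - cos (u * y)) \<partial>N)"
proof -
  define m where "m = cos_exponent u"
  have total: "(\<integral>\<^sup>+ y. ennreal (1 - cos (u * y)) \<partial>N) = ennreal m"
    unfolding m_def cos_exponent_def by (intro nn_integral_eq_integral integrable_one_minus_cos) auto
  show ?thesis
  proof (cases "m = 0")
    \<comment> \<open>Normalising by \<open>m\<close> is impossible here, but both halves are
      bounded by the total mass 0.\<close>
    case True
    have "(\<integral>\<^sup>+ y. ennreal (1 - cos (u * y)) * indicator A y \<partial>N) \<le> (\<integral>\<^sup>+ y. ennreal (1 - cos (u * y)) \<partial>N)" for A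
      by (intro nn_integral_mono) (auto split: split_indicator)
    then show ?thesis using True by (simp add: total)
  next
    case False
    then have m: "0 < m" using cos_exponent_nonneg[of u] by (simp add: m_def)
    define h where "h \<xi> y = Im (levy_integrand \<xi> y)" for \<xi> y
    have int_h: "integrable N (h \<xi>)" for \<xi>
      unfolding h_def using integrable_levy_integrand by (rule integrable_Im)
    have h: "(\<integral>y. h \<xi> y \<partial>N) = \<beta> * \<xi>" for \<xi>
      unfolding h_def integral_Im[OF integrable_levy_integrand] by (rule linear)
    have odd: "(\<integral>y. sin (\<xi> * y) * (1 - cos (u * y)) \<partial>N) = 0" for \<xi>
    proof -
      \<comment> \<open>The compensator is linear in \<xi>, so it cancels in the second difference,
        leaving only the sines. After integration the right-hand side vanishes for the same reason,
        by \<open>linear\<close>.\<close>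
      have "sin (\<xi> * y) * (1 - cos (u * y)) = h \<xi> y - (h (\<xi> + u) y + h (\<xi> - u) y) / 2" for y
        by (simp add: h_def levy_integrand_def Im_exp distrib_right left_diff_distrib sin_add sin_diff)
           (simp add: field_simps)
      then have "(\<integral>y. sin (\<xi> * y) * (1 - cos (u * y)) \<partial>N)
          = (\<integral>y. h \<xi> y - (h (\<xi> + u) y + h (\<xi> - u) y) / 2 \<partial>N)" by simp
      also have "\<dots> = 0" using int_h by (simp add: h algebra_simps)
      finally show ?thesis .
    qed
    \<comment> \<open>Division by \<open>m\<close> makes this a probability measure, so that
      uniqueness of characteristic functions applies.\<close>
    define M where "M = density N (\<lambda>y. ennreal ((1 - cos (u * y)) / m))"
    have emeasure_M: "emeasure M A = ennreal (1 / m) * (\<integral>\<^sup>+ y\<in>A. ennreal (1 - cos (u * y)) \<partial>N)"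
      if "A \<in> sets borel" for A
    proof -
      have "emeasure M A = (\<integral>\<^sup>+ y. ennreal (1 / m) * (ennreal (1 - cos (u * y)) * indicator A y) \<partial>N)"
        unfolding M_def using that m
        by (simp add: emeasure_density mult.assoc[symmetric] ennreal_mult[symmetric])
      then show ?thesis using that by (simp add: nn_integral_cmult)
    qed
    have sets_M [simp, measurable_cong]: "sets M = sets borel" by (simp add: M_def)
    have "emeasure M UNIV = 1"
      using m by (simp add: emeasure_M total ennreal_mult[symmetric])
    then interpret M: real_distribution M
      by (intro real_distribution.intro real_distribution_axioms.intro prob_spaceI)
         (simp_all add: M_def)
    let ?M' = "distr M borel uminus"
    have M': "real_distribution ?M'"
      by (intro M.real_distribution_distr) measurable
    have Im_char: "Im (char M t) = 0" for t
    proof -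
      have "Im (char M t) = (\<integral>y. Im (iexp (t * y)) \<partial>M)"
        unfolding char_def by (intro integral_Im[symmetric] M.integrable_iexp) auto
      also have "\<dots> = (\<integral>y. (1 - cos (u * y)) / m * sin (t * y) \<partial>N)"
        unfolding M_def using m by (subst integral_density) (auto simp: Im_exp)
      also have "\<dots> = (\<integral>y. sin (t * y) * (1 - cos (u * y)) \<partial>N) / m"
        by (simp add: mult.commute)
      finally show ?thesis by (simp add: odd)
    qed
    \<comment> \<open>Reflection conjugates the characteristic function, which is real.\<close>
    have "char ?M' = char M"
    proof
      fix t
      have "char ?M' t = (\<integral>y. cnj (iexp (t * y)) \<partial>M)"
        unfolding char_def by (subst integral_distr) (auto simp: exp_cnj)
      also have "\<dots> = cnj (char M t)"
        unfolding char_def by (rule Bochner_Integration.integral_cnj)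
      finally show "char ?M' t = char M t" using Im_char[of t] by (simp add: complex_eq_iff)
    qed
    then have "?M' = M" by (intro Levy_uniqueness M' M.real_distribution_axioms)
    moreover have "emeasure ?M' {0<..} = emeasure M {..<0}"
      by (subst emeasure_distr) (auto intro!: arg_cong[where f = "emeasure M"])
    ultimately have eq: "emeasure M {..<0} = emeasure M {0<..}" by simp
    have "(\<integral>\<^sup>+ y\<in>A. ennreal (1 - cos (u * y)) \<partial>N) = ennreal m * emeasure M A" if "A \<in> sets borel" for A
      using m by (simp add: emeasure_M[OF that] mult.assoc[symmetric] ennreal_mult[symmetric])
    then show ?thesis by (simp add: eq)
  qed
qed

text \<open>Lets a condition on the positive half-line alone control the whole exponent.\<close>

lemma cos_exponent_eq_positive_half:
  assumes "\<And>\<xi>. Im (\<integral>y. levy_integrand \<xi> y \<partial>N) = \<beta> * \<xi>"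
  shows "ennreal (cos_exponent u) = 2 * (\<integral>\<^sup>+ y\<in>{0<..}. ennreal (1 - cos (u * y)) \<partial>N)"
proof -
  let ?f = "\<lambda>y. ennreal (1 - cos (u * y))"
  have "ennreal (cos_exponent u) = (\<integral>\<^sup>+ y. ?f y \<partial>N)"
    unfolding cos_exponent_def
    by (intro nn_integral_eq_integral[symmetric] integrable_one_minus_cos) auto
  \<comment> \<open>The origin is lost in the splitting, but the integrand is 0 there.\<close>
  also have "\<dots> = (\<integral>\<^sup>+ y. ?f y * indicator {0<..} y + ?f y * indicator {..<0} y \<partial>N)"
  proof (intro nn_integral_cong)
    fix y :: real
    show "?f y = ?f y * indicator {0<..} y + ?f y * indicator {..<0} y"
      by (cases "y = 0") (auto split: split_indicator)
  qed
  also have "\<dots> = 2 * (\<integral>\<^sup>+ y\<in>{0<..}. ?f y \<partial>N)"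
    by (simp add: nn_integral_add nn_integral_negative_half[OF assms] mult_2)
  finally show ?thesis .
qed

end

text \<open>The sets on which \<open>min 1 (y\<^sup>2)\<close> is at least
  \<open>1 / (n + 1)\<close> have finite mass for both measures and miss only the origin, a null set
  of \<open>N1\<close>.\<close>

lemma nn_integral_le_add_variation_diff:
  assumes "levy_measure N1" "levy_measure N2" and zero: "emeasure N1 {0} = 0"
    and f: "f \<in> borel_measurable borel"
  shows "(\<integral>\<^sup>+y. f y \<partial>N1) \<le> (\<integral>\<^sup>+y. f y \<partial>N2) + (\<integral>\<^sup>+y. f y \<partial>variation_diff N1 N2)"
proof -
  interpret N1: levy_measure N1 by fact
  interpret N2: levy_measure N2 by fact
  let ?A = "\<lambda>n. {y::real. 1 / real (Suc n) \<le> min 1 (y\<^sup>2)}"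
  have "UNIV - (\<Union>n. ?A n) \<subseteq> {0}"
  proof (rule ccontr)
    assume "\<not> UNIV - (\<Union>n. ?A n) \<subseteq> {0}"
    then obtain y :: real where y: "y \<noteq> 0" "\<And>n. y \<notin> ?A n" by blast
    have "0 < min 1 (y\<^sup>2)" using y by simp
    then obtain n where "inverse (real (Suc n)) < min 1 (y\<^sup>2)" using reals_Archimedean by blast
    then have "y \<in> ?A n" by (simp add: inverse_eq_divide)
    then show False using y(2) by blast
  qed
  then have "emeasure N1 (UNIV - (\<Union>n. ?A n)) \<le> emeasure N1 {0}"
    by (intro emeasure_mono) auto
  then have null: "emeasure N1 (space N1 - (\<Union>n. ?A n)) = 0" using zero by simp
  have inc: "incseq ?A"
  proof (rule incseq_SucI, rule subsetI)
    fix n and y :: real assume "y \<in> ?A n"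
    moreover have "1 / real (Suc (Suc n)) \<le> 1 / real (Suc n)" by (simp add: frac_le)
    ultimately show "y \<in> ?A (Suc n)" by (simp del: of_nat_Suc)
  qed
  show ?thesis
  proof (rule nn_integral_le_add_of_emeasure_le)
    show "emeasure N1 B \<le> emeasure N2 B + emeasure (variation_diff N1 N2) B" if "B \<in> sets N1" for B
      using that N1.emeasure_away_from_zero_finite N2.emeasure_away_from_zero_finite inc null
      by (intro emeasure_le_emeasure_add_variation_diff[where A = ?A]) auto
    show "f \<in> borel_measurable N1" using f by (simp add: measurable_cong_sets[OF N1.sets_N refl])
  qed auto
qed

section \<open>Symbols of symmetric processes\<close>

context symmetric_nice_feller_process
begin

sublocale levy: levy_measure "\<nu> x" for x
  by unfold_locales (use sets_levy_measure levy_measure_integrable in auto)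

lemma symbol_eq:
  "q x \<xi> = complex_of_real (a x) - \<i> * complex_of_real (\<xi> * b x)
     + complex_of_real (c x * \<xi>\<^sup>2 / 2) - (\<integral>y. levy.levy_integrand \<xi> y \<partial>\<nu> x)"
  unfolding representation levy_khintchine_def levy.levy_integrand_def ..

text \<open>At \<xi> = 0 every other term of the representation vanishes.\<close>

lemma killing_rate_zero: "a x = 0"
  using C3[of x] by (simp add: symbol_eq levy.levy_integrand_def)

lemma Re_symbol: "Re (q x \<xi>) = c x * \<xi>\<^sup>2 / 2 + levy.cos_exponent x \<xi>"
  by (simp add: symbol_eq killing_rate_zero levy.Re_levy_integral)

text \<open>In a real symbol the drift term must balance the imaginary part of the jump integral,
  which is therefore linear in \<xi>. This supplies the hypothesis from which the balance of the
  half-lines is derived.\<close>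

lemma Im_levy_integral: "Im (\<integral>y. levy.levy_integrand \<xi> y \<partial>\<nu> x) = - b x * \<xi>"
proof -
  have "Im (q x \<xi>) = 0" by (subst symmetric) simp
  then show ?thesis by (simp add: symbol_eq mult.commute)
qed

lemma Re_symbol_nonneg: "0 \<le> Re (q x \<xi>)"
  using nonneg_coefficients(2)[of x] levy.cos_exponent_nonneg[of x \<xi>] by (simp add: Re_symbol)

lemma cmod_symbol: "cmod (q x \<xi>) = Re (q x \<xi>)"
  by (subst symmetric) (simp add: Re_symbol_nonneg)

lemma diffusion_bounded: "\<exists>C>0. \<forall>x. c x \<le> C"
proof -
  obtain C where C: "0 \<le> C" "\<And>\<xi> x. cmod (q x \<xi>) \<le> C * (1 + \<xi>\<^sup>2)" using C2 by blast
  \<comment> \<open>At \<xi> = 1 the growth bound reads \<open>c x / 2 \<le> 2 * C\<close>; the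
    added 1 makes the constant positive.\<close>
  have "c x \<le> 4 * C + 1" for x
    using C(2)[of x 1] levy.cos_exponent_nonneg[of x 1] by (simp add: cmod_symbol Re_symbol)
  then show ?thesis using C(1) by (intro exI[of _ "4 * C + 1"]) auto
qed

text \<open>Real suprema are meaningful only for bounded sets; the growth condition provides the
  bound for each fixed \<xi>.\<close>

lemma bdd_above_symbol: "bdd_above (range (\<lambda>x. Re (q x \<xi>)))"
proof -
  obtain C where "\<And>\<xi> x. cmod (q x \<xi>) \<le> C * (1 + \<xi>\<^sup>2)" using C2 by blast
  then show ?thesis unfolding cmod_symbol by (rule bdd_aboveI2)
qed

lemma bdd_below_symbol: "bdd_below (range (\<lambda>x. Re (q x \<xi>)))"
  using Re_symbol_nonneg by (rule bdd_belowI2)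

lemma continuous_Re_symbol: "continuous_on UNIV (\<lambda>\<xi>. Re (q x \<xi>))"
  unfolding Re_symbol by (intro continuous_intros levy.continuous_cos_exponent) simp

lemma Re_symbol_diff_le: "Re (q x (\<xi> - \<eta>)) \<le> 2 * Re (q x \<xi>) + 2 * Re (q x \<eta>)"
proof -
  have "(\<xi> - \<eta>)\<^sup>2 \<le> 2 * \<xi>\<^sup>2 + 2 * \<eta>\<^sup>2"
    using zero_le_power2[of "\<xi> + \<eta>"] by (simp add: power2_eq_square algebra_simps)
  then have "c x * (\<xi> - \<eta>)\<^sup>2 \<le> c x * (2 * \<xi>\<^sup>2 + 2 * \<eta>\<^sup>2)"
    using nonneg_coefficients(2) by (rule mult_left_mono)
  then show ?thesis
    using levy.cos_exponent_diff_le[of x \<xi> \<eta>] by (simp add: Re_symbol distrib_left)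
qed

lemma Re_symbol_of_int_mult_le: "Re (q x (of_int k * \<xi>)) \<le> (of_int k)\<^sup>2 * Re (q x \<xi>)"
  using levy.cos_exponent_of_int_mult_le[of x k \<xi>]
  by (simp add: Re_symbol power_mult_distrib algebra_simps)

text \<open>By \<open>cmod_symbol\<close> this is also the supremum of the moduli.\<close>

definition sup_symbol :: "real \<Rightarrow> real" where
  "sup_symbol \<xi> = (SUP x. Re (q x \<xi>))"

definition inf_symbol :: "real \<Rightarrow> real" where
  "inf_symbol \<xi> = (INF x. Re (q x \<xi>))"

lemma Re_symbol_le_sup: "Re (q x \<xi>) \<le> sup_symbol \<xi>"
  unfolding sup_symbol_def by (intro cSUP_upper bdd_above_symbol) simp

lemma sup_symbol_leI: "(\<And>x. Re (q x \<xi>) \<le> C) \<Longrightarrow> sup_symbol \<xi> \<le> C"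
  unfolding sup_symbol_def by (intro cSUP_least) auto

lemma inf_symbol_le: "inf_symbol \<xi> \<le> Re (q x \<xi>)"
  unfolding inf_symbol_def by (intro cINF_lower bdd_below_symbol) simp

lemma inf_symbol_geI: "(\<And>x. C \<le> Re (q x \<xi>)) \<Longrightarrow> C \<le> inf_symbol \<xi>"
  unfolding inf_symbol_def by (intro cINF_greatest) auto

lemma sup_symbol_nonneg: "0 \<le> sup_symbol \<xi>"
  using Re_symbol_nonneg Re_symbol_le_sup by (rule order_trans)

lemma inf_symbol_nonneg: "0 \<le> inf_symbol \<xi>"
  by (intro inf_symbol_geI Re_symbol_nonneg)

text \<open>A supremum of continuous functions is lower semicontinuous: it exceeds \<open>t\<close>
  exactly where one of the functions does.\<close>

lemma open_sup_symbol: "open {\<xi>. t < sup_symbol \<xi>}"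
proof -
  have "{\<xi>. t < sup_symbol \<xi>} = (\<Union>x. {\<xi>. t < Re (q x \<xi>)})"
    unfolding sup_symbol_def by (auto simp: less_cSUP_iff bdd_above_symbol)
  also have "open \<dots>"
    by (intro open_UN ballI open_Collect_less continuous_Re_symbol continuous_on_const)
  finally show ?thesis .
qed

text \<open>The infimum runs over uncountably many \<open>x\<close>, so measurability comes from
  upper semicontinuity.\<close>

lemma borel_measurable_inf_symbol: "inf_symbol \<in> borel_measurable borel"
proof -
  have "open {\<xi>. inf_symbol \<xi> < t}" for t
  proof -
    have "{\<xi>. inf_symbol \<xi> < t} = (\<Union>x. {\<xi>. Re (q x \<xi>) < t})"
      unfolding inf_symbol_def by (auto simp: cINF_less_iff bdd_below_symbol)
    also have "open \<dots>"
      by (intro open_UN ballI open_Collect_less continuous_Re_symbol continuous_on_const)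
    finally show ?thesis .
  qed
  then show ?thesis unfolding borel_measurable_iff_less by auto
qed

lemma sup_symbol_diff_le: "sup_symbol (\<xi> - \<eta>) \<le> 2 * sup_symbol \<xi> + 2 * sup_symbol \<eta>"
proof (rule sup_symbol_leI)
  show "Re (q x (\<xi> - \<eta>)) \<le> 2 * sup_symbol \<xi> + 2 * sup_symbol \<eta>" for x
    using Re_symbol_diff_le[of x \<xi> \<eta>] Re_symbol_le_sup[of x \<xi>] Re_symbol_le_sup[of x \<eta>] by linarith
qed

lemma sup_symbol_of_int_mult_le: "sup_symbol (of_int k * \<xi>) \<le> (of_int k)\<^sup>2 * sup_symbol \<xi>"
proof (rule sup_symbol_leI)
  show "Re (q x (of_int k * \<xi>)) \<le> (of_int k)\<^sup>2 * sup_symbol \<xi>" for x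
    using Re_symbol_of_int_mult_le[of x k \<xi>] mult_left_mono[OF Re_symbol_le_sup[of x \<xi>], of "(of_int k)\<^sup>2"]
    by simp
qed

end

section \<open>Comparison of two symbols\<close>

text \<open>One-sided on purpose: part (b) uses it as it stands, part (a) with the two processes
  exchanged.\<close>

lemma symbol_le_add_quadratic:
  assumes proc1: "symmetric_nice_feller_process \<Omega>\<^sub>1 P\<^sub>1 F\<^sub>1 q\<^sub>1 a\<^sub>1 b\<^sub>1 c\<^sub>1 \<nu>\<^sub>1"
    and proc2: "symmetric_nice_feller_process \<Omega>\<^sub>2 P\<^sub>2 F\<^sub>2 q\<^sub>2 a\<^sub>2 b\<^sub>2 c\<^sub>2 \<nu>\<^sub>2"
    and finite: "(SUP x. \<integral>\<^sup>+ y\<in>{0<..}. ennreal (y\<^sup>2) \<partial>variation_diff (\<nu>\<^sub>1 x) (\<nu>\<^sub>2 x)) < \<infinity>"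
  shows "\<exists>K>0. \<forall>x \<xi>. Re (q\<^sub>1 x \<xi>) \<le> Re (q\<^sub>2 x \<xi>) + K * \<xi>\<^sup>2"
proof -
  interpret p1: symmetric_nice_feller_process \<Omega>\<^sub>1 P\<^sub>1 F\<^sub>1 q\<^sub>1 a\<^sub>1 b\<^sub>1 c\<^sub>1 \<nu>\<^sub>1 by (rule proc1)
  interpret p2: symmetric_nice_feller_process \<Omega>\<^sub>2 P\<^sub>2 F\<^sub>2 q\<^sub>2 a\<^sub>2 b\<^sub>2 c\<^sub>2 \<nu>\<^sub>2 by (rule proc2)
  let ?V = "\<lambda>x. variation_diff (\<nu>\<^sub>1 x) (\<nu>\<^sub>2 x)"
  obtain d where d: "0 \<le> d" "(SUP x. \<integral>\<^sup>+ y\<in>{0<..}. ennreal (y\<^sup>2) \<partial>?V x) = ennreal d"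
    using finite by (cases "SUP x. \<integral>\<^sup>+ y\<in>{0<..}. ennreal (y\<^sup>2) \<partial>?V x") auto
  obtain C where C: "0 < C" "\<And>x. c\<^sub>1 x \<le> C" using p1.diffusion_bounded by blast
  have "p1.levy.cos_exponent x \<xi> \<le> p2.levy.cos_exponent x \<xi> + d * \<xi>\<^sup>2" for x \<xi>
  proof -
    let ?f = "\<lambda>y. ennreal (1 - cos (\<xi> * y)) * indicator {0<..} y"
    have [measurable_cong]: "sets (?V x) = sets borel" by simp
    have "(\<integral>\<^sup>+ y. ?f y \<partial>?V x) \<le> (\<integral>\<^sup>+ y. ennreal (\<xi>\<^sup>2 / 2) * (ennreal (y\<^sup>2) * indicator {0<..} y) \<partial>?V x)"
    proof (intro nn_integral_mono)
      fix y :: real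
      have "ennreal (1 - cos (\<xi> * y)) \<le> ennreal (\<xi>\<^sup>2 / 2 * y\<^sup>2)"
        using one_minus_cos_le[of "\<xi> * y"] by (intro ennreal_leI) (simp add: power_mult_distrib)
      also have "\<dots> = ennreal (\<xi>\<^sup>2 / 2) * ennreal (y\<^sup>2)" by (intro ennreal_mult) auto
      finally show "?f y \<le> ennreal (\<xi>\<^sup>2 / 2) * (ennreal (y\<^sup>2) * indicator {0<..} y)"
        by (simp add: mult.assoc[symmetric] mult_right_mono)
    qed
    also have "\<dots> = ennreal (\<xi>\<^sup>2 / 2) * (\<integral>\<^sup>+ y\<in>{0<..}. ennreal (y\<^sup>2) \<partial>?V x)"
      by (intro nn_integral_cmult) measurable
    also have "\<dots> \<le> ennreal (\<xi>\<^sup>2 / 2) * ennreal d"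
      unfolding d(2)[symmetric] by (intro mult_left_mono SUP_upper) auto
    also have "\<dots> = ennreal (d * \<xi>\<^sup>2 / 2)"
      using d(1) by (subst ennreal_mult[symmetric]) (auto simp: mult.commute)
    finally have V: "(\<integral>\<^sup>+ y. ?f y \<partial>?V x) \<le> ennreal (d * \<xi>\<^sup>2 / 2)" .
    have "ennreal (p1.levy.cos_exponent x \<xi>) = 2 * (\<integral>\<^sup>+ y. ?f y \<partial>\<nu>\<^sub>1 x)"
      by (rule p1.levy.cos_exponent_eq_positive_half[OF p1.Im_levy_integral])
    also have "\<dots> \<le> 2 * ((\<integral>\<^sup>+ y. ?f y \<partial>\<nu>\<^sub>2 x) + (\<integral>\<^sup>+ y. ?f y \<partial>?V x))"
      by (intro mult_left_mono nn_integral_le_add_variation_diff p1.levy.levy_measure_axioms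
          p2.levy.levy_measure_axioms p1.levy_measure_zero) auto
    also have "\<dots> = ennreal (p2.levy.cos_exponent x \<xi>) + 2 * (\<integral>\<^sup>+ y. ?f y \<partial>?V x)"
      by (simp add: distrib_left p2.levy.cos_exponent_eq_positive_half[OF p2.Im_levy_integral])
    \<comment> \<open>The 2 for the two half-lines cancels the 1/2 of the quadratic bound on
      \<open>1 - cos\<close>.\<close>
    also have "\<dots> \<le> ennreal (p2.levy.cos_exponent x \<xi>) + ennreal 2 * ennreal (d * \<xi>\<^sup>2 / 2)"
      using V by (intro add_left_mono) (simp add: mult_left_mono)
    also have "\<dots> = ennreal (p2.levy.cos_exponent x \<xi> + d * \<xi>\<^sup>2)"
      using d(1) p2.levy.cos_exponent_nonneg
      by (simp only: ennreal_mult[symmetric] ennreal_plus[symmetric] mult_nonneg_nonneg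
          zero_le_power2 zero_le_numeral divide_nonneg_pos zero_less_numeral) simp
    finally show ?thesis
      using d(1) p2.levy.cos_exponent_nonneg[of x \<xi>] by (subst (asm) ennreal_le_iff) auto
  qed
  \<comment> \<open>The diffusion parts are compared crudely: \<open>c\<^sub>1\<close> is bounded
    above by \<open>C\<close>, \<open>c\<^sub>2\<close> below by 0.\<close>
  moreover have "c\<^sub>1 x * \<xi>\<^sup>2 / 2 \<le> C * \<xi>\<^sup>2" for x \<xi>
    using mult_right_mono[OF C(2)[of x], of "\<xi>\<^sup>2"] p1.nonneg_coefficients(2)[of x]
    by (smt (verit) field_sum_of_halves mult_nonneg_nonneg zero_le_power2)
  moreover have "0 \<le> c\<^sub>2 x * \<xi>\<^sup>2 / 2" for x \<xi>
    using p2.nonneg_coefficients(2)[of x] by simp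
  ultimately have "Re (q\<^sub>1 x \<xi>) \<le> Re (q\<^sub>2 x \<xi>) + (C + d) * \<xi>\<^sup>2" for x \<xi>
    unfolding p1.Re_symbol p2.Re_symbol distrib_right by (smt (verit))
  moreover have "0 < C + d" using C(1) d(1) by simp
  ultimately show ?thesis by blast
qed

theorem theorem3p1:
  fixes \<Omega>\<^sub>1 :: "'w1 measure" and P\<^sub>1 :: "real \<Rightarrow> 'w1 measure" and F\<^sub>1 :: "real \<Rightarrow> 'w1 \<Rightarrow> real"
    and \<Omega>\<^sub>2 :: "'w2 measure" and P\<^sub>2 :: "real \<Rightarrow> 'w2 measure" and F\<^sub>2 :: "real \<Rightarrow> 'w2 \<Rightarrow> real"
    and q\<^sub>1 q\<^sub>2 :: "real \<Rightarrow> real \<Rightarrow> complex"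
    and a\<^sub>1 b\<^sub>1 c\<^sub>1 a\<^sub>2 b\<^sub>2 c\<^sub>2 :: "real \<Rightarrow> real"
    and \<nu>\<^sub>1 \<nu>\<^sub>2 :: "real \<Rightarrow> real measure"
  assumes "symmetric_nice_feller_process \<Omega>\<^sub>1 P\<^sub>1 F\<^sub>1 q\<^sub>1 a\<^sub>1 b\<^sub>1 c\<^sub>1 \<nu>\<^sub>1"
    and "symmetric_nice_feller_process \<Omega>\<^sub>2 P\<^sub>2 F\<^sub>2 q\<^sub>2 a\<^sub>2 b\<^sub>2 c\<^sub>2 \<nu>\<^sub>2"
  shows
    "((SUP x. \<integral>\<^sup>+ y\<in>{0<..}. ennreal (y\<^sup>2) \<partial>variation_diff (\<nu>\<^sub>1 x) (\<nu>\<^sub>2 x)) < \<infinity> \<longrightarrow>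
      (\<exists>r>0. (\<integral>\<^sup>+ \<xi>\<in>{\<xi>. \<bar>\<xi>\<bar> < r}. 1 / ennreal (SUP x. cmod (q\<^sub>1 x \<xi>)) \<partial>lborel) = \<infinity>) \<longrightarrow>
      (\<exists>r>0. (\<integral>\<^sup>+ \<xi>\<in>{\<xi>. \<bar>\<xi>\<bar> < r}. 1 / ennreal (SUP x. cmod (q\<^sub>2 x \<xi>)) \<partial>lborel) = \<infinity>))
     \<and>
     ((SUP x. \<integral>\<^sup>+ y\<in>{0<..}. ennreal (y\<^sup>2) \<partial>variation_diff (\<nu>\<^sub>1 x) (\<nu>\<^sub>2 x)) < \<infinity> \<longrightarrow>
      (\<exists>r>0. (\<integral>\<^sup>+ \<xi>\<in>{\<xi>. \<bar>\<xi>\<bar> < r}. 1 / ennreal (INF x. Re (q\<^sub>1 x \<xi>)) \<partial>lborel) < \<infinity>) \<longrightarrow>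
      filterlim (\<lambda>\<xi>. (INF x. Re (q\<^sub>1 x \<xi>)) / \<xi>\<^sup>2) at_top (at 0) \<longrightarrow>
      (\<exists>r>0. (\<integral>\<^sup>+ \<xi>\<in>{\<xi>. \<bar>\<xi>\<bar> < r}. 1 / ennreal (INF x. Re (q\<^sub>2 x \<xi>)) \<partial>lborel) < \<infinity>) \<and>
      filterlim (\<lambda>\<xi>. (INF x. Re (q\<^sub>2 x \<xi>)) / \<xi>\<^sup>2) at_top (at 0))"
proof -
  interpret p1: symmetric_nice_feller_process \<Omega>\<^sub>1 P\<^sub>1 F\<^sub>1 q\<^sub>1 a\<^sub>1 b\<^sub>1 c\<^sub>1 \<nu>\<^sub>1 by (rule assms(1))
  interpret p2: symmetric_nice_feller_process \<Omega>\<^sub>2 P\<^sub>2 F\<^sub>2 q\<^sub>2 a\<^sub>2 b\<^sub>2 c\<^sub>2 \<nu>\<^sub>2 by (rule assms(2))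
  \<comment> \<open>Part (a) bounds the second symbol by the first, so the variation condition is
    needed with the Levy measures exchanged.\<close>
  have commute: "variation_diff (\<nu>\<^sub>2 x) (\<nu>\<^sub>1 x) = variation_diff (\<nu>\<^sub>1 x) (\<nu>\<^sub>2 x)" for x
    by (rule variation_diff_commute) simp
  show ?thesis
    unfolding p1.cmod_symbol p2.cmod_symbol p1.sup_symbol_def[symmetric] p2.sup_symbol_def[symmetric]
      p1.inf_symbol_def[symmetric] p2.inf_symbol_def[symmetric]
  proof (intro conjI impI)
    assume fin: "(SUP x. \<integral>\<^sup>+ y\<in>{0<..}. ennreal (y\<^sup>2) \<partial>variation_diff (\<nu>\<^sub>1 x) (\<nu>\<^sub>2 x)) < \<infinity>"
    obtain K where K: "0 < K" "\<And>x \<xi>. Re (q\<^sub>2 x \<xi>) \<le> Re (q\<^sub>1 x \<xi>) + K * \<xi>\<^sup>2"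
      using symbol_le_add_quadratic[OF assms(2,1)] fin unfolding commute by blast
    have le: "p2.sup_symbol \<xi> \<le> p1.sup_symbol \<xi> + K * \<xi>\<^sup>2" for \<xi>
      using K(2) p1.Re_symbol_le_sup by (intro p2.sup_symbol_leI) (meson add_right_mono order_trans)
    assume "\<exists>r>0. (\<integral>\<^sup>+ \<xi>\<in>{\<xi>. \<bar>\<xi>\<bar> < r}. 1 / ennreal (p1.sup_symbol \<xi>) \<partial>lborel) = \<infinity>"
    then obtain r where "(\<integral>\<^sup>+ \<xi>\<in>{\<xi>. \<bar>\<xi>\<bar> < r}. 1 / ennreal (p1.sup_symbol \<xi>) \<partial>lborel) = \<infinity>" by blast
    with p1.sup_symbol_nonneg p2.sup_symbol_nonneg p1.open_sup_symbol p2.open_sup_symbol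
      p1.sup_symbol_diff_le p1.sup_symbol_of_int_mult_le K(1) le
    show "\<exists>r>0. (\<integral>\<^sup>+ \<xi>\<in>{\<xi>. \<bar>\<xi>\<bar> < r}. 1 / ennreal (p2.sup_symbol \<xi>) \<partial>lborel) = \<infinity>"
      by (rule infinite_integral_transfer)
  next
    assume fin: "(SUP x. \<integral>\<^sup>+ y\<in>{0<..}. ennreal (y\<^sup>2) \<partial>variation_diff (\<nu>\<^sub>1 x) (\<nu>\<^sub>2 x)) < \<infinity>"
    obtain K where K: "0 < K" "\<And>x \<xi>. Re (q\<^sub>1 x \<xi>) \<le> Re (q\<^sub>2 x \<xi>) + K * \<xi>\<^sup>2"
      using symbol_le_add_quadratic[OF assms fin] by blast
    have le: "p1.inf_symbol \<xi> \<le> p2.inf_symbol \<xi> + K * \<xi>\<^sup>2" for \<xi>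
    proof -
      have "p1.inf_symbol \<xi> - K * \<xi>\<^sup>2 \<le> p2.inf_symbol \<xi>"
      proof (rule p2.inf_symbol_geI)
        show "p1.inf_symbol \<xi> - K * \<xi>\<^sup>2 \<le> Re (q\<^sub>2 x \<xi>)" for x
          using K(2)[of x \<xi>] p1.inf_symbol_le[of \<xi> x] by linarith
      qed
      then show ?thesis by linarith
    qed
    assume "\<exists>r>0. (\<integral>\<^sup>+ \<xi>\<in>{\<xi>. \<bar>\<xi>\<bar> < r}. 1 / ennreal (p1.inf_symbol \<xi>) \<partial>lborel) < \<infinity>"
      and lim: "filterlim (\<lambda>\<xi>. p1.inf_symbol \<xi> / \<xi>\<^sup>2) at_top (at 0)"
    then obtain r where r: "0 < r"
      "(\<integral>\<^sup>+ \<xi>\<in>{\<xi>. \<bar>\<xi>\<bar> < r}. 1 / ennreal (p1.inf_symbol \<xi>) \<partial>lborel) < \<infinity>" by blast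
    note transfer = finite_integral_transfer[OF p1.inf_symbol_nonneg p2.inf_symbol_nonneg
        p1.borel_measurable_inf_symbol K(1) le r lim]
    show "\<exists>r>0. (\<integral>\<^sup>+ \<xi>\<in>{\<xi>. \<bar>\<xi>\<bar> < r}. 1 / ennreal (p2.inf_symbol \<xi>) \<partial>lborel) < \<infinity>"
      by (rule transfer(1))
    show "filterlim (\<lambda>\<xi>. p2.inf_symbol \<xi> / \<xi>\<^sup>2) at_top (at 0)"
      by (rule transfer(2))
  qed
qed

end
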